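(* Let $K$ be an uncountable compact metric space and let $d\in \mathbb{N}^+$. Then for a prevalent $f\in C(K,\mathbb{R}^d)$ we have \[ \dim_H \operatorname{graph}(f)=\dim_H K+d. \]
   Context: $C(K,\mathbb{R}^d)$ is the Banach space of continuous maps $K\to\mathbb{R}^d$ with the maximum norm, viewed as an abelian Polish group. A set $A\subset G$ in an abelian Polish group is shy if there exist a Borel set $B\supset A$ and a Borel probability measure $\mu$ on $G$ with $\mu(B+x)=0$ for all $x\in G$; prevalent means complement shy; "for a prevalent $f$" means the set of such $f$ contains a prevalent set. $K\times\mathbb{R}^d$ carries the metric $\sqrt{\rho(x_1,x_2)^2+|z_1-z_2|^2}$ and $\operatorname{graph}(f)=\{(x,f(x)):x\in K\}$. $\dim_H$ denotes Hausdorff dimension. *)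

theory Defs
  imports "HOL-Analysis.Analysis" "HOL-Probability.Probability"
begin

definition hdiam :: "'a::metric_space set \<Rightarrow> ennreal" where
  "hdiam S = (SUP x\<in>S. SUP y\<in>S. ennreal (dist x y))"

definition hpow :: "'a::metric_space set \<Rightarrow> real \<Rightarrow> ennreal" where
  "hpow U s = (if U = {} then 0 else if s = 0 then 1
               else if hdiam U = \<infinity> then \<infinity> else ennreal (enn2real (hdiam U) powr s))"

definition hausdorff_pre :: "real \<Rightarrow> real \<Rightarrow> 'a::metric_space set \<Rightarrow> ennreal" where
  "hausdorff_pre s \<delta> A =
     (INF U\<in>{U::nat \<Rightarrow> 'a set. A \<subseteq> (\<Union>i. U i) \<and> (\<forall>i. hdiam (U i) \<le> ennreal \<delta>)}.
        (\<Sum>i. hpow (U i) s))"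

definition hausdorff_measure :: "real \<Rightarrow> 'a::metric_space set \<Rightarrow> ennreal" where
  "hausdorff_measure s A = (SUP \<delta>\<in>{0<..}. hausdorff_pre s \<delta> A)"

definition hausdorff_dim :: "'a::metric_space set \<Rightarrow> ereal" where
  "hausdorff_dim A = Inf {ereal s | s. s \<ge> 0 \<and> hausdorff_measure s A = 0}"

definition shy :: "'g::{ab_group_add, topological_space} set \<Rightarrow> bool" where
  "shy A \<longleftrightarrow> (\<exists>B \<in> sets borel. A \<subseteq> B \<and>
      (\<exists>\<mu>. prob_space \<mu> \<and> sets \<mu> = sets (borel :: 'g measure) \<and>
           (\<forall>x. emeasure \<mu> ((\<lambda>b. b + x) ` B) = 0)))"

definition prevalent :: "'g::{ab_group_add, topological_space} set \<Rightarrow> bool" where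
  "prevalent A \<longleftrightarrow> shy (- A)"

definition graph :: "('a::metric_space \<Rightarrow>\<^sub>C 'b::metric_space) \<Rightarrow> ('a \<times> 'b) set" where
  "graph f = (\<lambda>x. (x, f x)) ` UNIV"

end

theory Submission
  imports Defs "HOL-Real_Asymp.Real_Asymp"
begin

text \<open>
  The upper bound holds for every \<open>f\<close>: a cover of \<open>K\<close> by balls of radius \<open>\<rho>\<close> is refined to a
  cover of \<open>K \<times> [-M, M]\<^sup>d\<close> by \<open>O(\<rho> powr - d)\<close> times as many balls of comparable radius.

  For the lower bound, the law of a random function \<open>\<Sum>k. (k + 1) powr - 2 * \<psi> (\<Sum>i. \<omega> (k, i) * g (k, i))\<close>
  witnesses shyness of the exceptional set. Here \<open>\<psi>\<close> is a triangle wave, the \<open>g (k, i)\<close> are bumps at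
  the points of a finite \<open>r k / 4\<close>-net, and the vectors \<open>\<omega> (k, i)\<close> are independent and uniform
  in a cube. Folding by \<open>\<psi>\<close> keeps the series uniformly convergent no matter how
  many bumps overlap, yet if \<open>dist x y > r k\<close> then, conditionally on everything
  but one \<open>\<omega> (k, i)\<close>, the increment between \<open>x\<close> and \<open>y\<close> has a density \<open>O((k + 1) powr (2 * d))\<close>. The bound is
  insensitive to adding a fixed continuous \<open>g\<close>. If the nets are equipped with discrete
  measures \<open>\<mu>\<close> of mass bounded below that are spread out enough, the expected \<open>t\<close>-energy of the
  lift of \<open>\<mu>\<close> to the graph is bounded, and Fatou's lemma gives almost surely a bounded subsequence;
  this forces the Hausdorff measure of the graph in every dimension up to \<open>t\<close> to be nonzero.

  If \<open>dim K > 0\<close>, the discrete measures are of Frostman type. They come from increasing the weights of the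
  points of a net greedily: in a maximal configuration every point lies in a ball
  whose mass constraint is an equality, and a Vitali selection of such balls bounds the mass
  below by the Hausdorff content. If \<open>dim K = 0\<close>, only \<open>t < d\<close> is needed; a binary tree
  of disjoint compact sets in the uncountable space \<open>K\<close> carries uniform measures, and the \<open>r k\<close> are
  chosen smaller than the separation of the \<open>k\<close>-th level.
\<close>

section \<open>Null sets of Hausdorff measures and the upper bound\<close>

lemma ennreal_dist_le_hdiam: "x \<in> S \<Longrightarrow> y \<in> S \<Longrightarrow> ennreal (dist x y) \<le> hdiam S"
  unfolding hdiam_def by (rule SUP_upper2[of x], assumption, rule SUP_upper)

lemma ennreal_le_suminf: "f i \<le> (\<Sum>i. f i)" for f :: "nat \<Rightarrow> ennreal"
  using sum_le_suminf[of f "{i}"] by (simp add: summableI)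

text \<open>A set of diameter \<open>\<delta> i\<close> lies in an open ball about any of its points
  with radius slightly above \<open>\<delta> i\<close>; the enlargements cost a geometric series of
  total \<open>\<eta>/2\<close>. Open balls are the form in which compactness can be applied
  later.\<close>

lemma hausdorff_null_imp_ball_cover:
  fixes A :: "'a::metric_space set"
  assumes null: "hausdorff_measure s A = 0" and s: "s > 0" and \<eta>: "\<eta> > 0"
  shows "\<exists>z \<rho>. (\<forall>i::nat. 0 \<le> \<rho> i) \<and> A \<subseteq> (\<Union>i. ball (z i) (\<rho> i)) \<and>
    (\<Sum>i. ennreal (\<rho> i powr s)) \<le> ennreal \<eta>"
proof -
  \<comment> \<open>The scale 1 serves to make all diameters of the cover finite.\<close>
  have "hausdorff_pre s 1 A \<le> hausdorff_measure s A"
    unfolding hausdorff_measure_def by (rule SUP_upper) auto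
  then have "hausdorff_pre s 1 A < ennreal (\<eta>/2)" using null \<eta> by simp
  then obtain U where U: "A \<subseteq> (\<Union>i. U i)" "\<And>i. hdiam (U i) \<le> ennreal 1"
     "(\<Sum>i. hpow (U i) s) < ennreal (\<eta>/2)"
    unfolding hausdorff_pre_def INF_less_iff by blast
  define \<delta> where "\<delta> i = enn2real (hdiam (U i))" for i
  have \<delta>: "hdiam (U i) = ennreal (\<delta> i)" "hdiam (U i) \<noteq> \<infinity>" for i
    using U(2)[of i] unfolding \<delta>_def
    by (metis ennreal_enn2real ennreal_less_top order_le_less_trans)
       (metis U(2) ennreal_less_top infinity_ennreal_def less_irrefl order_le_less_trans)
  have \<delta>0: "\<delta> i \<ge> 0" for i unfolding \<delta>_def by simp
  define e where "e i = (\<eta>/2) * (1/2)^(Suc i)" for i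
  have e0: "e i > 0" for i using \<eta> unfolding e_def by simp
  \<comment> \<open>The radius solves \<open>\<rho> i powr s = \<delta> i powr s + e i\<close>, so
    it is positive even for singletons; an empty set gets radius 0 and hence an empty ball.\<close>
  define \<rho> where "\<rho> i = (if U i = {} then 0 else (\<delta> i powr s + e i) powr (1/s))" for i
  define z where "z i = (SOME x. x \<in> U i)" for i
  have z: "z i \<in> U i" if "U i \<noteq> {}" for i
    unfolding z_def using that some_in_eq by metis
  have less: "\<delta> i < \<rho> i" if "U i \<noteq> {}" for i
  proof -
    have "\<delta> i = (\<delta> i powr s) powr (1/s)" using s \<delta>0[of i] by (simp add: powr_powr)
    also have "\<dots> < (\<delta> i powr s + e i) powr (1/s)"
      using s e0[of i] by (intro powr_less_mono2) auto
    finally show ?thesis using that unfolding \<rho>_def by simp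
  qed
  have sub: "U i \<subseteq> ball (z i) (\<rho> i)" for i
  proof
    fix y assume y: "y \<in> U i"
    then have ne: "U i \<noteq> {}" by auto
    have "ennreal (dist (z i) y) \<le> ennreal (\<delta> i)"
      using ennreal_dist_le_hdiam[OF z[OF ne] y] \<delta>(1) by simp
    then have "dist (z i) y \<le> \<delta> i" using \<delta>0 by (simp add: ennreal_le_iff)
    then show "y \<in> ball (z i) (\<rho> i)" using less[OF ne] by simp
  qed
  have pw: "ennreal (\<rho> i powr s) \<le> hpow (U i) s + ennreal (e i)" for i
  proof (cases "U i = {}")
    case True then show ?thesis using s by (simp add: \<rho>_def)
  next
    case False
    have "\<rho> i powr s = \<delta> i powr s + e i"
      using False s e0[of i] by (simp add: \<rho>_def powr_powr add_nonneg_nonneg)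
    moreover have "hpow (U i) s = ennreal (\<delta> i powr s)"
      using False s \<delta>(2)[of i] by (simp add: hpow_def \<delta>_def)
    ultimately show ?thesis using e0[of i] by (simp add: ennreal_plus)
  qed
  have es: "e sums (\<eta>/2)"
    unfolding e_def using sums_mult[OF power_half_series, of "\<eta>/2"] by simp
  have e_sum: "(\<Sum>i. ennreal (e i)) = ennreal (\<eta>/2)"
    using es e0 by (intro suminf_ennreal_eq) (auto intro: less_imp_le)
  have "(\<Sum>i. ennreal (\<rho> i powr s)) \<le> (\<Sum>i. hpow (U i) s + ennreal (e i))"
    by (rule suminf_le) (auto simp: pw)
  also have "\<dots> = (\<Sum>i. hpow (U i) s) + (\<Sum>i. ennreal (e i))"
    by (rule suminf_add[symmetric]) auto
  also have "\<dots> \<le> ennreal (\<eta>/2) + ennreal (\<eta>/2)"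
    unfolding e_sum by (rule add_right_mono[OF less_imp_le[OF U(3)]])
  finally have "(\<Sum>i. ennreal (\<rho> i powr s)) \<le> ennreal (\<eta>/2) + ennreal (\<eta>/2)" .
  then have "(\<Sum>i. ennreal (\<rho> i powr s)) \<le> ennreal \<eta>"
    using \<eta> by (simp flip: ennreal_plus)
  moreover have "A \<subseteq> (\<Union>i. ball (z i) (\<rho> i))" using U(1) sub by blast
  moreover have "0 \<le> \<rho> i" for i unfolding \<rho>_def by simp
  ultimately show ?thesis by blast
qed

text \<open>A small sum forces every single radius to be small, so covers that are cheap are
  automatically fine and serve at every scale.\<close>

lemma ball_covers_imp_hausdorff_null:
  fixes A :: "'a::metric_space set"
  assumes s: "s > 0"
    and cov: "\<And>\<eta>. \<eta> > 0 \<Longrightarrow> \<exists>z \<rho>. (\<forall>i::nat. 0 \<le> \<rho> i) \<and> A \<subseteq> (\<Union>i. ball (z i) (\<rho> i)) \<and>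
      (\<Sum>i. ennreal (\<rho> i powr s)) \<le> ennreal \<eta>"
  shows "hausdorff_measure s A = 0"
proof -
  have "hausdorff_pre s \<delta> A \<le> 0 + ennreal \<epsilon>" if \<delta>: "\<delta> > 0" and \<epsilon>: "\<epsilon> > 0" for \<delta> \<epsilon>
  proof -
    \<comment> \<open>The first entry gives \<open>2 * \<rho> i \<le> \<delta>\<close>; the second
      absorbs the factor \<open>2 powr s\<close> lost in passing from radius to diameter.\<close>
    define \<eta> where "\<eta> = min ((\<delta>/2) powr s) (\<epsilon> / 2 powr s)"
    have "\<eta> > 0" using \<delta> \<epsilon> by (simp add: \<eta>_def)
    then obtain z :: "nat \<Rightarrow> 'a" and \<rho> where c: "\<And>i::nat. 0 \<le> \<rho> i" "A \<subseteq> (\<Union>i. ball (z i) (\<rho> i))"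
      "(\<Sum>i. ennreal (\<rho> i powr s)) \<le> ennreal \<eta>" using cov by blast
    have hd: "hdiam (ball (z i) (\<rho> i)) \<le> ennreal (2 * \<rho> i)" for i
      unfolding hdiam_def
    proof (intro SUP_least ennreal_leI)
      fix x y assume "x \<in> ball (z i) (\<rho> i)" "y \<in> ball (z i) (\<rho> i)"
      then show "dist x y \<le> 2 * \<rho> i"
        using dist_triangle[of x y "z i"] by (simp add: dist_commute)
    qed
    have rd: "2 * \<rho> i \<le> \<delta>" for i
    proof -
      have "ennreal (\<rho> i powr s) \<le> (\<Sum>i. ennreal (\<rho> i powr s))"
        by (rule ennreal_le_suminf)
      then have "ennreal (\<rho> i powr s) \<le> ennreal \<eta>" using c(3) by (rule order_trans)
      then have "\<rho> i powr s \<le> (\<delta>/2) powr s"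
        using \<open>\<eta> > 0\<close> by (simp add: ennreal_le_iff \<eta>_def)
      then have "\<rho> i \<le> \<delta>/2"
        using s \<delta> c(1)[of i] by (meson half_gt_zero less_imp_le not_le powr_less_mono2)
      then show ?thesis by simp
    qed
    have hp: "hpow (ball (z i) (\<rho> i)) s \<le> ennreal (2 powr s) * ennreal (\<rho> i powr s)" for i
    proof -
      have "hdiam (ball (z i) (\<rho> i)) \<noteq> \<infinity>"
        using hd[of i] by (metis ennreal_neq_top infinity_ennreal_def top.extremum_unique)
      moreover have "enn2real (hdiam (ball (z i) (\<rho> i))) \<le> 2 * \<rho> i"
        using hd[of i] c(1)[of i] by (simp add: enn2real_leI)
      then have "enn2real (hdiam (ball (z i) (\<rho> i))) powr s \<le> (2 * \<rho> i) powr s"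
        using s by (intro powr_mono2) auto
      ultimately show ?thesis using s c(1)[of i]
        by (auto simp: hpow_def powr_mult ennreal_mult[symmetric] intro!: ennreal_leI)
    qed
    have "hausdorff_pre s \<delta> A \<le> (\<Sum>i. hpow (ball (z i) (\<rho> i)) s)"
      unfolding hausdorff_pre_def
    proof (rule INF_lower, safe)
      show "x \<in> (\<Union>i. ball (z i) (\<rho> i))" if "x \<in> A" for x using that c(2) by blast
      show "hdiam (ball (z i) (\<rho> i)) \<le> ennreal \<delta>" for i
        using hd[of i] rd[of i] by (meson ennreal_leI order_trans)
    qed
    also have "\<dots> \<le> (\<Sum>i. ennreal (2 powr s) * ennreal (\<rho> i powr s))"
      by (rule suminf_le) (auto simp: hp)
    also have "\<dots> = ennreal (2 powr s) * (\<Sum>i. ennreal (\<rho> i powr s))" by simp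
    also have "\<dots> \<le> ennreal (2 powr s) * ennreal \<eta>" by (intro mult_left_mono c(3)) simp
    also have "\<dots> = ennreal (2 powr s * \<eta>)" using \<open>\<eta> > 0\<close> by (simp add: ennreal_mult)
    also have "\<dots> \<le> ennreal \<epsilon>"
      by (rule ennreal_leI) (simp add: \<eta>_def min_def field_simps)
    finally show ?thesis by simp
  qed
  then have "hausdorff_pre s \<delta> A = 0" if "\<delta> > 0" for \<delta>
    using ennreal_le_epsilon[of 0 "hausdorff_pre s \<delta> A"] that by simp
  then show ?thesis unfolding hausdorff_measure_def by simp
qed

section \<open>Dimension bounds from null sets\<close>

text \<open>At exponent 0 every nonempty member of a cover counts 1. This keeps the exponent 0 out
  of the infimum that defines the dimension, so that all other arguments may work with positive
  exponents.\<close>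

lemma hausdorff_measure_0_nonzero:
  assumes "A \<noteq> {}"
  shows "hausdorff_measure 0 A \<noteq> 0"
proof
  assume "hausdorff_measure 0 A = 0"
  moreover have "hausdorff_pre 0 1 A \<le> hausdorff_measure 0 A"
    unfolding hausdorff_measure_def by (rule SUP_upper) auto
  ultimately have "hausdorff_pre 0 1 A < 1" by simp
  then obtain U where U: "A \<subseteq> (\<Union>i. U i)" "(\<Sum>i. hpow (U i) 0) < 1"
    unfolding hausdorff_pre_def INF_less_iff by blast
  obtain x i where "x \<in> U i" using assms U(1) by blast
  then have "hpow (U i) 0 = 1" by (auto simp: hpow_def)
  moreover have "hpow (U i) 0 \<le> (\<Sum>i. hpow (U i) 0)"
    by (rule ennreal_le_suminf)
  ultimately show False using U(2) by simp
qed

lemma hausdorff_dim_lower: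
  assumes "A \<noteq> {}" and "\<And>s. 0 < s \<Longrightarrow> ereal s < D \<Longrightarrow> hausdorff_measure s A \<noteq> 0"
  shows "D \<le> hausdorff_dim A"
  unfolding hausdorff_dim_def
proof (rule Inf_greatest, safe)
  fix s :: real assume s: "0 \<le> s" "hausdorff_measure s A = 0"
  then have "s \<noteq> 0" using hausdorff_measure_0_nonzero[OF assms(1)] by metis
  then show "D \<le> ereal s" using s assms(2)[of s] by (meson not_le order_le_less)
qed

lemma hausdorff_dim_upper:
  assumes "0 \<le> s" "hausdorff_measure s A = 0"
  shows "hausdorff_dim A \<le> ereal s"
  unfolding hausdorff_dim_def using assms by (intro Inf_lower) auto

lemma hausdorff_measure_nonzero_below_dim:
  assumes "0 \<le> s" "ereal s < hausdorff_dim A"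
  shows "hausdorff_measure s A \<noteq> 0"
  using hausdorff_dim_upper[OF assms(1)] assms(2) by (meson not_le)

lemma hausdorff_dim_nonneg: "0 \<le> hausdorff_dim A"
  unfolding hausdorff_dim_def by (rule Inf_greatest) auto

lemma hausdorff_null_above_dim:
  assumes "hausdorff_dim A < ereal s" "A \<noteq> {}"
  obtains s' where "0 < s'" "s' < s" "hausdorff_measure s' A = 0"
proof -
  obtain s' where "0 \<le> s'" "s' < s" "hausdorff_measure s' A = 0"
    using assms(1) unfolding hausdorff_dim_def Inf_less_iff by auto
  moreover then have "s' \<noteq> 0" using hausdorff_measure_0_nonzero[OF assms(2)] by metis
  ultimately show ?thesis using that[of s'] by simp
qed

section \<open>Products with a box and the upper bound\<close>

text \<open>Rounding every coordinate down to a multiple of \<open>\<rho>\<close> gives an error of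
  at most \<open>\<rho>\<close> per coordinate, and the norm is at most the l1 norm.\<close>

lemma box_grid:
  fixes M \<rho> :: real
  assumes "\<rho> > 0" "M > 0"
  shows "\<exists>G :: (real^'n::finite) set. finite G \<and> real (card G) \<le> (2*M/\<rho> + 3) ^ CARD('n) \<and>
     (\<forall>y. norm y \<le> M \<longrightarrow> (\<exists>g\<in>G. norm (y - g) \<le> CARD('n) * \<rho>))"
proof -
  define k where "k = \<lceil>M/\<rho>\<rceil>"
  define G where "G = (\<lambda>h. \<chi> m. \<rho> * real_of_int (h m)) ` (PiE (UNIV::'n set) (\<lambda>_. {-k..k}))"
  have k0: "k \<ge> 0"
    using divide_pos_pos[OF assms(2,1)] unfolding k_def by linarith
  have fin: "finite (PiE (UNIV::'n set) (\<lambda>_. {-k..k}))" by (intro finite_PiE) auto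
  have "card G \<le> card (PiE (UNIV::'n set) (\<lambda>_. {-k..k}))"
    unfolding G_def by (rule card_image_le[OF fin])
  also have "\<dots> = (nat (2*k+1)) ^ CARD('n)" by (simp add: card_PiE)
  finally have "real (card G) \<le> (real (nat (2*k+1))) ^ CARD('n)"
    by (metis of_nat_mono of_nat_power)
  also have "\<dots> \<le> (2*M/\<rho> + 3) ^ CARD('n)"
  proof (rule power_mono)
    have "real_of_int k \<le> M/\<rho> + 1" unfolding k_def by linarith
    then show "real (nat (2*k+1)) \<le> 2*M/\<rho> + 3" using k0 by simp
  qed simp
  finally have c: "real (card G) \<le> (2*M/\<rho> + 3) ^ CARD('n)" .
  have "\<exists>g\<in>G. norm (y - g) \<le> CARD('n) * \<rho>" if y: "norm y \<le> M" for y :: "real^'n"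
  proof -
    define h where "h m = \<lfloor>y $ m / \<rho>\<rfloor>" for m
    have "h m \<in> {-k..k}" for m
    proof -
      have a: "\<bar>y $ m\<bar> \<le> M" using y component_le_norm_cart[of y m] by linarith
      have "y $ m / \<rho> \<le> M / \<rho>" "- (M / \<rho>) \<le> y $ m / \<rho>"
        using a assms by (auto simp: divide_simps)
      then show ?thesis unfolding h_def k_def by (simp add: floor_le_iff le_floor_iff) linarith
    qed
    then have "h \<in> PiE UNIV (\<lambda>_. {-k..k})" by (auto simp: PiE_def)
    then have g: "(\<chi> m. \<rho> * real_of_int (h m)) \<in> G" unfolding G_def by blast
    have "norm (y - (\<chi> m. \<rho> * real_of_int (h m))) \<le> (\<Sum>m\<in>UNIV. \<bar>y $ m - \<rho> * real_of_int (h m)\<bar>)"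
      using norm_le_l1_cart[of "y - (\<chi> m. \<rho> * real_of_int (h m))"] by simp
    also have "\<dots> \<le> (\<Sum>m\<in>(UNIV::'n set). \<rho>)"
    proof (rule sum_mono)
      fix m
      have "y $ m / \<rho> - 1 \<le> h m" "h m \<le> y $ m / \<rho>" unfolding h_def by linarith+
      then have "y $ m - \<rho> \<le> \<rho> * h m" "\<rho> * h m \<le> y $ m" using assms(1)
        by (auto simp: field_simps)
      then show "\<bar>y $ m - \<rho> * real_of_int (h m)\<bar> \<le> \<rho>" by linarith
    qed
    finally show ?thesis using g by (intro bexI[of _ "\<chi> m. \<rho> * real_of_int (h m)"]) auto
  qed
  moreover have "finite G" unfolding G_def using fin by simp
  ultimately show ?thesis using c by blast
qed

text \<open>Over a ball of radius \<open>\<rho> i\<close> the box is covered by about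
  \<open>\<rho> i powr - d\<close> balls of comparable radius, where d is the dimension of the box.
  Each contributes about \<open>\<rho> i powr (s + d)\<close>, so together they cost a constant
  times \<open>\<rho> i powr s\<close>.\<close>

lemma hausdorff_null_Times:
  fixes A :: "'a::metric_space set" and M :: real
  assumes null: "hausdorff_measure s A = 0" and s: "s > 0" and M: "M > 0"
  shows "hausdorff_measure (s + CARD('n)) (A \<times> cball (0 :: real^'n::finite) M) = 0"
proof (rule ball_covers_imp_hausdorff_null)
  let ?d = "CARD('n)"
  show "0 < s + ?d" using s by (simp add: add_pos_nonneg)
  fix \<eta> :: real assume \<eta>: "\<eta> > 0"
  \<comment> \<open>The first factor comes from the size of the grid, the second from the enlarged
    radius \<open>(?d + 2) * \<rho> i\<close>.\<close>
  define C where "C = (2*M+3) ^ ?d * (real ?d + 2) powr (s + ?d)"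
  have C: "C > 0" using M by (simp add: C_def)
  \<comment> \<open>The cap 1 forces all radii to be at most 1, whence
    \<open>2*M/\<rho> i + 3 \<le> (2*M+3)/\<rho> i\<close>.\<close>
  define \<eta>' where "\<eta>' = min 1 (\<eta> / C)"
  have \<eta>': "\<eta>' > 0" using \<eta> C by (simp add: \<eta>'_def)
  obtain z \<rho> where c: "\<And>i::nat. 0 \<le> \<rho> i" "A \<subseteq> (\<Union>i. ball (z i) (\<rho> i))"
    "(\<Sum>i. ennreal (\<rho> i powr s)) \<le> ennreal \<eta>'"
    using hausdorff_null_imp_ball_cover[OF null s \<eta>'] by blast
  have r1: "\<rho> i \<le> 1" for i
  proof -
    have "ennreal (\<rho> i powr s) \<le> (\<Sum>i. ennreal (\<rho> i powr s))"
      by (rule ennreal_le_suminf)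
    then have "ennreal (\<rho> i powr s) \<le> ennreal 1" using c(3) ennreal_leI[of \<eta>' 1]
      by (metis \<eta>'_def min.cobounded1 order_trans)
    then have "\<rho> i powr s \<le> 1 powr s" using ennreal_le_iff[of 1] by simp
    then show ?thesis using s c(1)[of i] by (meson not_le powr_less_mono2 zero_le_one)
  qed
  have "\<exists>G :: (real^'n) set. finite G \<and> (\<rho> i > 0 \<longrightarrow> real (card G) \<le> (2*M/\<rho> i + 3) ^ ?d \<and>
     (\<forall>y. norm y \<le> M \<longrightarrow> (\<exists>g\<in>G. norm (y - g) \<le> ?d * \<rho> i)))" for i
    using box_grid[OF _ M, of "\<rho> i"] by (cases "\<rho> i > 0") auto
  then obtain G :: "nat \<Rightarrow> (real^'n) set" where G: "\<And>i. finite (G i)"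
    "\<And>i. \<rho> i > 0 \<Longrightarrow> real (card (G i)) \<le> (2*M/\<rho> i + 3) ^ ?d"
    "\<And>i y. \<rho> i > 0 \<Longrightarrow> norm y \<le> M \<Longrightarrow> (\<exists>g\<in>G i. norm (y - g) \<le> ?d * \<rho> i)"
    by metis
  \<comment> \<open>The radius adds \<open>\<rho> i\<close> for the first component,
    \<open>?d * \<rho> i\<close> for the grid and one more \<open>\<rho> i\<close> as slack. Indices
    beyond the grid get empty balls.\<close>
  define r where "r = (\<lambda>(i,j). if j < card (G i) then (real ?d + 2) * \<rho> i else 0)"
  define w where "w = (\<lambda>(i,j). (z i, from_nat_into (G i) j))"
  have cov: "A \<times> cball (0::real^'n) M \<subseteq> (\<Union>p. ball (w p) (r p))"
  proof safe
    fix x and y :: "real^'n" assume x: "x \<in> A" and y: "y \<in> cball 0 M"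
    obtain i where i: "x \<in> ball (z i) (\<rho> i)" using c(2) x by blast
    then have pos: "\<rho> i > 0" using zero_le_dist[of "z i" x] by (simp del: zero_le_dist)
    obtain g where g: "g \<in> G i" "norm (y - g) \<le> ?d * \<rho> i" using G(3)[OF pos] y by auto
    obtain j where j: "j < card (G i)" "g = from_nat_into (G i) j"
      using g(1) bij_betw_from_nat_into_finite[OF G(1), of i] unfolding bij_betw_def by auto
    have "dist (w (i,j)) (x,y) \<le> dist (z i) x + dist g y"
      unfolding w_def using j(2) by (auto simp: dist_Pair_Pair sqrt_sum_squares_le_sum)
    also have "\<dots> < \<rho> i + ?d * \<rho> i + \<rho> i" using i g(2) pos by (simp add: dist_norm norm_minus_commute)
    also have "\<dots> = r (i,j)" using j by (simp add: r_def algebra_simps)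
    finally show "(x,y) \<in> (\<Union>p. ball (w p) (r p))" by auto
  qed
  have inner: "(\<Sum>j. ennreal (r (i,j) powr (s + ?d))) \<le> ennreal C * ennreal (\<rho> i powr s)" for i
  proof (cases "\<rho> i > 0")
    case False
    then have "\<rho> i = 0" using c(1)[of i] by simp
    then have "r (i,j) = 0" for j by (simp add: r_def)
    then show ?thesis by simp
  next
    case True
    let ?t = "((real ?d + 2) * \<rho> i) powr (s + ?d)"
    have "(\<Sum>j. ennreal (r (i,j) powr (s + ?d))) = (\<Sum>j<card (G i). ennreal ?t)"
      by (subst suminf_finite[of "{..<card (G i)}"]) (auto simp: r_def)
    also have "\<dots> = ennreal (card (G i) * ?t)" by (simp add: ennreal_mult ennreal_of_nat_eq_real_of_nat)
    also have "\<dots> \<le> ennreal (C * \<rho> i powr s)"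
    proof (rule ennreal_leI)
      have "2*M/\<rho> i + 3 \<le> (2*M+3) / \<rho> i" using True r1[of i] by (simp add: field_simps)
      then have "(2*M/\<rho> i + 3) ^ ?d \<le> ((2*M+3) / \<rho> i) ^ ?d"
        using True M by (intro power_mono) auto
      then have a: "real (card (G i)) \<le> (2*M+3) ^ ?d / \<rho> i ^ ?d"
        using G(2)[OF True] by (simp add: power_divide)
      have b: "?t = (real ?d + 2) powr (s + ?d) * (\<rho> i powr s * \<rho> i ^ ?d)"
        using True by (simp add: powr_mult powr_add powr_realpow)
      have "card (G i) * ?t \<le> (2*M+3) ^ ?d / \<rho> i ^ ?d * ?t"
        by (rule mult_right_mono[OF a]) simp
      also have "\<dots> = C * \<rho> i powr s"
        unfolding b C_def using True by simp
      finally show "card (G i) * ?t \<le> C * \<rho> i powr s" .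
    qed
    finally show ?thesis using C by (simp add: ennreal_mult)
  qed
  have "(\<Sum>p. ennreal (r (prod_decode p) powr (s + ?d))) = (\<Sum>i. \<Sum>j. ennreal (r (i,j) powr (s + ?d)))"
    by (rule suminf_ennreal_2dimen) simp
  also have "\<dots> \<le> (\<Sum>i. ennreal C * ennreal (\<rho> i powr s))"
    by (rule suminf_le) (auto intro: inner)
  also have "\<dots> \<le> ennreal C * ennreal \<eta>'" by (simp add: mult_left_mono c(3))
  also have "\<dots> = ennreal (C * \<eta>')" using C \<eta>' by (simp add: ennreal_mult)
  also have "\<dots> \<le> ennreal \<eta>"
    using C by (intro ennreal_leI) (simp add: \<eta>'_def min_def field_simps)
  finally have "(\<Sum>p. ennreal (r (prod_decode p) powr (s + ?d))) \<le> ennreal \<eta>" .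
  moreover have "A \<times> cball (0::real^'n) M \<subseteq> (\<Union>p. ball (w (prod_decode p)) (r (prod_decode p)))"
  proof
    fix q assume "q \<in> A \<times> cball (0::real^'n) M"
    then obtain p where "q \<in> ball (w p) (r p)" using cov by blast
    then have "q \<in> ball (w (prod_decode (prod_encode p))) (r (prod_decode (prod_encode p)))" by simp
    then show "q \<in> (\<Union>p. ball (w (prod_decode p)) (r (prod_decode p)))" by blast
  qed
  moreover have "0 \<le> r p" for p using c(1) by (auto simp: r_def split: prod.split)
  ultimately show "\<exists>z \<rho>. (\<forall>i::nat. 0 \<le> \<rho> i) \<and> A \<times> cball (0::real^'n) M \<subseteq> (\<Union>i. ball (z i) (\<rho> i)) \<and>
      (\<Sum>i. ennreal (\<rho> i powr (s + ?d))) \<le> ennreal \<eta>"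
    by (intro exI[of _ "\<lambda>p. w (prod_decode p)"] exI[of _ "\<lambda>p. r (prod_decode p)"]) auto
qed

lemma hausdorff_null_mono:
  fixes A B :: "'a::metric_space set"
  assumes null: "hausdorff_measure s B = 0" and s: "s > 0" and sub: "A \<subseteq> B"
  shows "hausdorff_measure s A = 0"
proof (rule ball_covers_imp_hausdorff_null[OF s])
  fix \<eta> :: real assume "\<eta> > 0"
  then show "\<exists>z \<rho>. (\<forall>i::nat. 0 \<le> \<rho> i) \<and> A \<subseteq> (\<Union>i. ball (z i) (\<rho> i)) \<and>
      (\<Sum>i. ennreal (\<rho> i powr s)) \<le> ennreal \<eta>"
    using hausdorff_null_imp_ball_cover[OF null s, of \<eta>] sub by blast
qed

text \<open>As \<open>f\<close> is bounded, its graph lies in the product of the space with a ball.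
  The slack \<open>e\<close> is there because the infimum defining the dimension may not be
  attained.\<close>

lemma hausdorff_dim_graph_le:
  fixes f :: "'a::metric_space \<Rightarrow>\<^sub>C (real^'n::finite)"
  shows "hausdorff_dim (graph f) \<le> hausdorff_dim (UNIV :: 'a set) + ereal (real CARD('n))"
proof (rule ereal_le_epsilon2)
  fix e :: real assume e: "e > 0"
  let ?D = "hausdorff_dim (UNIV :: 'a set)"
  show "hausdorff_dim (graph f) \<le> ?D + ereal (real CARD('n)) + ereal e"
  proof (cases "?D = \<infinity>")
    case True then show ?thesis by simp
  next
    case False
    then obtain D where D: "?D = ereal D" using hausdorff_dim_nonneg[of "UNIV::'a set"] by (cases ?D) auto
    obtain s where s: "0 < s" "s < D + e" "hausdorff_measure s (UNIV::'a set) = 0"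
      using hausdorff_null_above_dim[of "UNIV::'a set" "D + e"] D e by auto
    have gr: "graph f \<subseteq> UNIV \<times> cball 0 (norm f + 1)"
      unfolding graph_def using norm_bounded[of f] by (force intro: order_trans)
    have "hausdorff_measure (s + CARD('n)) (graph f) = 0"
    proof (rule hausdorff_null_mono[OF hausdorff_null_Times[OF s(3) s(1)] _ gr])
      show "0 < norm f + 1" using norm_ge_zero[of f] by linarith
      show "0 < s + real CARD('n)" using s by (simp add: add_pos_nonneg)
    qed
    then have "hausdorff_dim (graph f) \<le> ereal (s + CARD('n))"
      using s by (intro hausdorff_dim_upper) auto
    also have "\<dots> \<le> ?D + ereal (real CARD('n)) + ereal e" using s D by simp
    finally show ?thesis .
  qed
qed

section \<open>The random function\<close>

text \<open>The distance from \<open>u\<close> to the nearest even integer: a triangle wave of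
  period 2 with slopes 1 and -1.\<close>

definition tri :: "real \<Rightarrow> real" where
  "tri u = \<bar>u - 2 * of_int (round (u / 2))\<bar>"

lemma tri_nonneg: "0 \<le> tri u"
  by (simp add: tri_def)

lemma tri_le_1: "tri u \<le> 1"
  using of_int_round_abs_le[of "u/2"] unfolding tri_def by linarith

lemma tri_le: "tri u \<le> \<bar>u - 2 * of_int m\<bar>"
  using round_diff_minimal[of "u/2" m] unfolding tri_def by linarith

lemma tri_lipschitz: "\<bar>tri u - tri v\<bar> \<le> \<bar>u - v\<bar>"
proof -
  have *: "tri u \<le> \<bar>u - v\<bar> + tri v" for u v
  proof -
    have "tri u \<le> \<bar>u - 2 * of_int (round (v/2))\<bar>" by (rule tri_le)
    also have "\<dots> \<le> \<bar>u - v\<bar> + \<bar>v - 2 * of_int (round (v/2))\<bar>" 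
      using abs_triangle_ineq[of "u - v" "v - 2 * of_int (round (v/2))"] by simp
    finally show ?thesis by (simp add: tri_def)
  qed
  show ?thesis using *[of u v] *[of v u] by (simp add: abs_if split: if_splits)
qed

lemma continuous_on_tri [continuous_intros]:
  assumes "continuous_on S f"
  shows "continuous_on S (\<lambda>x. tri (f x))"
proof -
  have "1-lipschitz_on UNIV tri"
    by (rule lipschitz_onI) (auto simp: dist_real_def tri_lipschitz)
  then have "continuous_on UNIV tri" by (rule lipschitz_on_continuous_on)
  then show ?thesis using assms by (rule continuous_on_compose2) auto
qed

text \<open>As \<open>u\<close> runs through the unit interval, \<open>u * g + c\<close> covers a
  length of at most 2 and meets at most three periods of the wave. Each period has two monotone
  branches of slope at least 1 in absolute value, so the set is covered by six intervals of length
  at most \<open>2 * \<rho>\<close>.\<close>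

lemma emeasure_tri_sublevel:
  assumes g: "1 \<le> g" "g \<le> 2" and \<rho>: "\<rho> \<ge> 0"
  shows "emeasure lborel {u\<in>{0..1}. \<bar>tri (u * g + c) - z\<bar> \<le> \<rho>} \<le> ennreal (12 * \<rho>)"
proof -
  \<comment> \<open>The nearest even integer \<open>2 * m\<close> satisfies
    \<open>(c - 1) / 2 \<le> m \<le> (c + 3) / 2\<close>, which leaves three candidates from
    \<open>m0\<close> on.\<close>
  define m0 where "m0 = \<lceil>(c - 1) / 2\<rceil>"
  \<comment> \<open>\<open>s\<close> is the sign of \<open>u * g + c - 2 * m\<close>, that is, the
    branch of the wave.\<close>
  define I where "I = (\<lambda>(m::int, s::real). {(2*m + s*z - c - \<rho>) / g .. (2*m + s*z - c + \<rho>) / g})"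
  have sub: "{u\<in>{0..1}. \<bar>tri (u * g + c) - z\<bar> \<le> \<rho>} \<subseteq> (\<Union>q\<in>{m0, m0+1, m0+2}\<times>{1,-1}. I q)"
  proof
    fix u assume u: "u \<in> {u\<in>{0..1}. \<bar>tri (u * g + c) - z\<bar> \<le> \<rho>}"
    then have u01: "0 \<le> u" "u \<le> 1" and ut: "\<bar>tri (u * g + c) - z\<bar> \<le> \<rho>"
      by (simp_all only: mem_Collect_eq atLeastAtMost_iff)
    define m where "m = round ((u * g + c) / 2)"
    have t: "tri (u * g + c) = \<bar>u * g + c - 2 * m\<bar>" by (simp add: tri_def m_def)
    have "\<bar>u * g + c - 2 * m\<bar> \<le> 1" using tri_le_1 t by metis
    moreover have "0 \<le> u * g" using u01 g by simp
    moreover have "u * g \<le> 1 * 2" using u01 g by (intro mult_mono) auto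
    ultimately have "(c - 1) / 2 \<le> m" "m \<le> (c + 3) / 2" by auto
    then have "m0 \<le> m" unfolding m0_def by (simp add: ceiling_le_iff)
    moreover have "real_of_int m \<le> m0 + 2"
    proof -
      have "(c - 1) / 2 \<le> m0" unfolding m0_def by (rule le_of_int_ceiling)
      then show ?thesis using \<open>m \<le> (c + 3) / 2\<close> by (simp add: field_simps)
    qed
    then have "m < m0 + 3" by linarith
    ultimately have "m0 \<le> m" "m < m0 + 3" by auto
    then have mm: "m \<in> {m0, m0+1, m0+2}" by auto
    have gp: "g > 0" using g by simp
    have key: "\<bar>\<bar>u * g + c - 2 * m\<bar> - z\<bar> \<le> \<rho>" using ut unfolding t .
    show "u \<in> (\<Union>q\<in>{m0, m0+1, m0+2}\<times>{1,-1}. I q)"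
    proof (cases "u * g + c - 2 * m \<ge> 0")
      case True
      then have "u \<in> I (m, 1)" using key gp by (auto simp: I_def field_simps)
      then show ?thesis using mm by blast
    next
      case False
      then have "u \<in> I (m, -1)" using key gp by (auto simp: I_def field_simps)
      then show ?thesis using mm by blast
    qed
  qed
  have "emeasure lborel {u\<in>{0..1}. \<bar>tri (u * g + c) - z\<bar> \<le> \<rho>} \<le>
      emeasure lborel (\<Union>q\<in>{m0, m0+1, m0+2}\<times>{1,-1}. I q)"
    by (rule emeasure_mono[OF sub]) (auto simp: I_def)
  also have "\<dots> \<le> (\<Sum>q\<in>{m0, m0+1, m0+2}\<times>{1,-1}. emeasure lborel (I q))"
    by (rule emeasure_subadditive_finite) (auto simp: I_def)
  also have "\<dots> \<le> (\<Sum>q\<in>{m0, m0+1, m0+2}\<times>{1,-1::real}. ennreal (2 * \<rho>))"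
  proof (rule sum_mono)
    fix q assume "q \<in> {m0, m0+1, m0+2}\<times>{1,-1::real}"
    obtain m s where q: "q = (m, s)" by (cases q)
    have "(2*m + s*z - c + \<rho>) / g - (2*m + s*z - c - \<rho>) / g = 2 * \<rho> / g"
      using g by (simp add: field_simps)
    moreover have "2 * \<rho> / g \<le> 2 * \<rho>" using g \<rho> by (simp add: divide_le_eq mult_le_cancel_left1)
    moreover have "(2*m + s*z - c - \<rho>) / g \<le> (2*m + s*z - c + \<rho>) / g"
      using g \<rho> by (simp add: divide_right_mono)
    ultimately show "emeasure lborel (I q) \<le> ennreal (2 * \<rho>)"
      unfolding q I_def by (simp add: ennreal_leI)
  qed
  also have "\<dots> = of_nat (card ({m0, m0+1, m0+2}\<times>{1,-1::real})) * ennreal (2 * \<rho>)"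
    by (rule sum_constant)
  also have "card ({m0, m0+1, m0+2}\<times>{1,-1::real}) = 6"
    by (simp add: card_cartesian_product)
  also have "of_nat 6 * ennreal (2 * \<rho>) = ennreal (12 * \<rho>)"
    unfolding ennreal_of_nat_eq_real_of_nat using \<rho> by (subst ennreal_mult[symmetric]) simp_all
  finally show ?thesis .
qed

section \<open>The random series in the space of bounded continuous functions\<close>

lemma continuous_on_eval_bcontfun:
  "continuous_on S (\<lambda>f::'a::topological_space \<Rightarrow>\<^sub>C 'b::metric_space. apply_bcontfun f z)"
proof -
  have "1-lipschitz_on S (\<lambda>f::'a \<Rightarrow>\<^sub>C 'b. apply_bcontfun f z)"
    by (rule lipschitz_onI) (auto simp: dist_bounded)
  then show ?thesis by (rule lipschitz_on_continuous_on)
qed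

text \<open>Makes the convergence tests for series in Banach spaces available for
  \<open>\<Rightarrow>\<^sub>C\<close>.\<close>

instance bcontfun :: (metric_space, banach) banach ..

text \<open>The constants make the bump at least 1 within distance \<open>r/4\<close> of
  \<open>p\<close> and zero from distance \<open>r/2\<close> on.\<close>

definition bump :: "real \<Rightarrow> 'a::metric_space \<Rightarrow> 'a \<Rightarrow> real" where
  "bump r p x = max 0 (2 - 4 * dist x p / r)"

lemma bump_bounds: "r > 0 \<Longrightarrow> 0 \<le> bump r p x \<and> bump r p x \<le> 2"
  by (auto simp: bump_def)

lemma continuous_on_bump: "r > 0 \<Longrightarrow> continuous_on S (bump r p)"
  unfolding bump_def by (intro continuous_intros) auto

text \<open>A single coefficient is a function on the coordinates rather than a vector, so that its
  law is a product measure \<open>PiM\<close>.\<close>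

type_synonym 'n coeffs = "nat \<times> nat \<Rightarrow> 'n \<Rightarrow> real"

text \<open>Summable, yet decaying only polynomially: powers of \<open>1 / amp k\<close> appear in
  the small ball estimate and have to be beaten by a geometric factor.\<close>

definition amp :: "nat \<Rightarrow> real" where "amp k = 1 / real (Suc k) ^ 2"

definition phase :: "(nat \<Rightarrow> real) \<Rightarrow> (nat \<Rightarrow> nat) \<Rightarrow> (nat \<Rightarrow> nat \<Rightarrow> 'a::metric_space) \<Rightarrow>
    nat \<Rightarrow> 'n coeffs \<Rightarrow> 'a \<Rightarrow> 'n \<Rightarrow> real" where
  "phase r N p k \<omega> x m = (\<Sum>i<N k. \<omega> (k,i) m * bump (r k) (p k i) x)"

definition wave :: "(nat \<Rightarrow> real) \<Rightarrow> (nat \<Rightarrow> nat) \<Rightarrow> (nat \<Rightarrow> nat \<Rightarrow> 'a::metric_space) \<Rightarrow>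
    nat \<Rightarrow> 'n::finite coeffs \<Rightarrow> ('a \<Rightarrow>\<^sub>C (real^'n))" where
  "wave r N p k \<omega> = Bcontfun (\<lambda>x. \<chi> m. tri (phase r N p k \<omega> x m))"

definition rfun :: "(nat \<Rightarrow> real) \<Rightarrow> (nat \<Rightarrow> nat) \<Rightarrow> (nat \<Rightarrow> nat \<Rightarrow> 'a::metric_space) \<Rightarrow>
    'n::finite coeffs \<Rightarrow> ('a \<Rightarrow>\<^sub>C (real^'n))" where
  "rfun r N p \<omega> = (\<Sum>k. amp k *\<^sub>R wave r N p k \<omega>)"

lemma amp_pos: "amp k > 0" by (simp add: amp_def)

lemma summable_amp: "summable amp"
  unfolding amp_def using inverse_power_summable[of 2, where 'a=real]
  by (subst summable_Suc_iff[of "\<lambda>k. 1 / real k ^ 2"]) (simp add: inverse_eq_divide)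

lemma norm_vec_le_card:
  fixes v :: "real^'n::finite" and b :: real
  assumes "\<And>m. \<bar>v $ m\<bar> \<le> b"
  shows "norm v \<le> CARD('n) * b"
proof -
  have "norm v \<le> (\<Sum>m\<in>UNIV. \<bar>v $ m\<bar>)" by (rule norm_le_l1_cart)
  also have "\<dots> \<le> (\<Sum>m\<in>(UNIV::'n set). b)" by (rule sum_mono) (rule assms)
  finally show ?thesis by simp
qed

lemma wave_apply:
  fixes \<omega> :: "'n::finite coeffs"
  assumes r: "\<And>k. r k > 0"
  shows "apply_bcontfun (wave r N p k \<omega>) x = (\<chi> m. tri (phase r N p k \<omega> x m))"
proof -
  have "(\<lambda>x. \<chi> m. tri (phase r N p k \<omega> x m)) \<in> bcontfun"
  proof (rule bcontfun_normI[of _ "real CARD('n) * 1"])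
    show "continuous_on UNIV (\<lambda>x. \<chi> m. tri (phase r N p k \<omega> x m))"
      unfolding phase_def using continuous_on_bump[OF r] by (intro continuous_intros) auto
    show "norm (\<chi> m. tri (phase r N p k \<omega> x m)) \<le> real CARD('n) * 1" for x
      by (rule norm_vec_le_card) (simp add: tri_nonneg tri_le_1)
  qed
  then show ?thesis unfolding wave_def by (simp add: Bcontfun_inverse)
qed

lemma norm_wave_le:
  fixes \<omega> :: "'n::finite coeffs"
  assumes r: "\<And>k. r k > 0"
  shows "norm (wave r N p k \<omega>) \<le> CARD('n)"
proof (rule norm_bound)
  show "norm (apply_bcontfun (wave r N p k \<omega>) x) \<le> CARD('n)" for x
    using norm_vec_le_card[of "apply_bcontfun (wave r N p k \<omega>) x" 1]
    by (simp add: wave_apply[OF r] tri_nonneg tri_le_1)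
qed

text \<open>Only finitely many coefficients enter the wave of level \<open>k\<close>, and it depends
  on them in a Lipschitz way uniformly in \<open>x\<close>. Hence continuity in the product topology
  yields continuity in the maximum norm.\<close>

lemma continuous_on_wave:
  fixes p :: "nat \<Rightarrow> nat \<Rightarrow> 'a::metric_space"
  assumes r: "\<And>k. r k > 0"
  shows "continuous_on UNIV (wave r N p k :: 'n::finite coeffs \<Rightarrow> _)"
  unfolding continuous_on_def
proof safe
  fix \<omega>\<^sub>0 :: "'n coeffs"
  define h where "h \<omega> = CARD('n) * (\<Sum>m\<in>UNIV. \<Sum>i<N k. \<bar>\<omega> (k,i) m - \<omega>\<^sub>0 (k,i) m\<bar> * 2)" for \<omega>
  have coord: "continuous_on UNIV (\<lambda>\<omega>::'n coeffs. \<omega> q m)" for q m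
    by (rule continuous_on_product_then_coordinatewise[OF continuous_on_product_coordinates])
  have "continuous_on UNIV h"
    unfolding h_def by (intro continuous_intros coord)
  then have "(h \<longlongrightarrow> h \<omega>\<^sub>0) (at \<omega>\<^sub>0)"
    by (simp add: continuous_on_def)
  moreover have "h \<omega>\<^sub>0 = 0" by (simp add: h_def)
  ultimately have h0: "(h \<longlongrightarrow> 0) (at \<omega>\<^sub>0)" by simp
  have "dist (wave r N p k \<omega>) (wave r N p k \<omega>\<^sub>0) \<le> h \<omega>" for \<omega>
  proof (rule dist_bound)
    fix x :: 'a
    show "dist (apply_bcontfun (wave r N p k \<omega>) x) (apply_bcontfun (wave r N p k \<omega>\<^sub>0) x) \<le> h \<omega>"
      unfolding dist_norm h_def
    proof (rule norm_vec_le_card)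
      fix m
      have "\<bar>(wave r N p k \<omega> x - wave r N p k \<omega>\<^sub>0 x) $ m\<bar> \<le> \<bar>phase r N p k \<omega> x m - phase r N p k \<omega>\<^sub>0 x m\<bar>"
        by (simp add: wave_apply[OF r] tri_lipschitz)
      also have "\<dots> = \<bar>\<Sum>i<N k. (\<omega> (k,i) m - \<omega>\<^sub>0 (k,i) m) * bump (r k) (p k i) x\<bar>"
        unfolding phase_def left_diff_distrib sum_subtractf ..
      also have "\<dots> \<le> (\<Sum>i<N k. \<bar>\<omega> (k,i) m - \<omega>\<^sub>0 (k,i) m\<bar> * 2)"
      proof (intro order_trans[OF sum_abs] sum_mono)
        fix i
        have "\<bar>bump (r k) (p k i) x\<bar> \<le> 2" using bump_bounds[OF r, of k "p k i" x] by simp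
        then show "\<bar>(\<omega> (k,i) m - \<omega>\<^sub>0 (k,i) m) * bump (r k) (p k i) x\<bar> \<le> \<bar>\<omega> (k,i) m - \<omega>\<^sub>0 (k,i) m\<bar> * 2"
          unfolding abs_mult by (rule mult_left_mono) simp
      qed
      also have "\<dots> \<le> (\<Sum>m\<in>UNIV. \<Sum>i<N k. \<bar>\<omega> (k,i) m - \<omega>\<^sub>0 (k,i) m\<bar> * 2)"
        by (rule member_le_sum) (auto intro: sum_nonneg)
      finally show "\<bar>(wave r N p k \<omega> x - wave r N p k \<omega>\<^sub>0 x) $ m\<bar> \<le> \<dots>" .
    qed
  qed
  then have "((\<lambda>\<omega>. dist (wave r N p k \<omega>) (wave r N p k \<omega>\<^sub>0)) \<longlongrightarrow> 0) (at \<omega>\<^sub>0)"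
    by (intro tendsto_sandwich[OF _ _ tendsto_const h0]) (auto intro: always_eventually)
  then show "(wave r N p k \<longlongrightarrow> wave r N p k \<omega>\<^sub>0) (at \<omega>\<^sub>0 within UNIV)"
    by (subst tendsto_dist_iff) simp
qed

lemma norm_amp_wave_le:
  fixes \<omega> :: "'n::finite coeffs"
  assumes r: "\<And>k. r k > 0"
  shows "norm (amp k *\<^sub>R wave r N p k \<omega>) \<le> amp k * CARD('n)"
  using norm_wave_le[OF r] amp_pos[of k] by (simp add: less_imp_le)

lemma summable_wave:
  fixes \<omega> :: "'n::finite coeffs"
  assumes r: "\<And>k. r k > 0"
  shows "summable (\<lambda>k. amp k *\<^sub>R wave r N p k \<omega>)"
  by (rule summable_comparison_test'[OF summable_mult2[OF summable_amp, of "real CARD('n)"]])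
     (rule norm_amp_wave_le[OF r])

text \<open>Folding bounds each term by \<open>amp k * CARD('n)\<close> uniformly in
  \<open>\<omega>\<close>, so the Weierstrass test applies. Continuity is what makes the random
  function Borel measurable.\<close>

lemma continuous_on_rfun:
  fixes p :: "nat \<Rightarrow> nat \<Rightarrow> 'a::metric_space"
  assumes r: "\<And>k. r k > 0"
  shows "continuous_on UNIV (rfun r N p :: 'n::finite coeffs \<Rightarrow> _)"
proof -
  have "uniform_limit UNIV (\<lambda>n \<omega>. \<Sum>k<n. amp k *\<^sub>R wave r N p k \<omega>)
      (rfun r N p :: 'n coeffs \<Rightarrow> _) sequentially"
    unfolding rfun_def
    by (rule Weierstrass_m_test[of _ _ "\<lambda>k. amp k * real CARD('n)"])
       (rule norm_amp_wave_le[OF r], rule summable_mult2[OF summable_amp])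
  then show ?thesis
    by (rule uniform_limit_theorem[rotated])
       (auto intro!: always_eventually continuous_intros continuous_on_wave[OF r])
qed

text \<open>A coefficient of level \<open>k\<close> enters no other wave, so the difference of the
  two series has a single nonzero term.\<close>

lemma rfun_upd:
  fixes \<omega> :: "'n::finite coeffs"
  assumes r: "\<And>k. r k > 0"
  shows "rfun r N p (fun_upd \<omega> (k,i) u) - rfun r N p \<omega> =
    amp k *\<^sub>R (wave r N p k (fun_upd \<omega> (k,i) u) - wave r N p k \<omega>)"
proof -
  let ?\<omega>' = "fun_upd \<omega> (k,i) u"
  have eq: "wave r N p j ?\<omega>' = wave r N p j \<omega>" if "j \<noteq> k" for j
    using that by (simp add: wave_def phase_def)
  have "rfun r N p ?\<omega>' - rfun r N p \<omega> = (\<Sum>j. amp j *\<^sub>R wave r N p j ?\<omega>' - amp j *\<^sub>R wave r N p j \<omega>)"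
    unfolding rfun_def by (rule suminf_diff) (rule summable_wave[OF r])+
  also have "\<dots> = (\<Sum>j\<in>{k}. amp j *\<^sub>R wave r N p j ?\<omega>' - amp j *\<^sub>R wave r N p j \<omega>)"
    by (rule suminf_finite) (auto simp: eq)
  finally show ?thesis by (simp add: scaleR_diff_right)
qed

section \<open>The law of the coefficients and the small ball estimate\<close>

abbreviation unif :: "real measure" where "unif \<equiv> uniform_measure lborel {0..1}"

definition coeff_measure :: "('n::finite \<Rightarrow> real) measure" where
  "coeff_measure = PiM UNIV (\<lambda>_. unif)"

definition coeffs_measure :: "'n::finite coeffs measure" where
  "coeffs_measure = PiM UNIV (\<lambda>_. coeff_measure)"

lemma prob_space_unif: "prob_space unif"
  by (rule prob_space_uniform_measure) auto

lemma prob_space_coeff_measure: "prob_space coeff_measure"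
  unfolding coeff_measure_def by (rule prob_space_PiM) (rule prob_space_unif)

lemma prob_space_coeffs_measure: "prob_space coeffs_measure"
  unfolding coeffs_measure_def by (rule prob_space_PiM) (rule prob_space_coeff_measure)

lemma sets_coeff_measure: "sets (coeff_measure :: ('n::finite \<Rightarrow> real) measure) = sets borel"
proof -
  have "sets (coeff_measure :: ('n::finite \<Rightarrow> real) measure) = sets (PiM (UNIV::'n set) (\<lambda>_. borel :: real measure))"
    unfolding coeff_measure_def by (rule sets_PiM_cong) auto
  then show ?thesis by (simp add: sets_PiM_equal_borel)
qed

text \<open>The index set is countable and the factors are second countable, so the product
  sigma-algebra is the Borel one and continuous maps are measurable.\<close>

lemma sets_coeffs_measure: "sets (coeffs_measure :: 'n::finite coeffs measure) = sets borel"
proof -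
  have "sets (coeffs_measure :: 'n::finite coeffs measure) =
      sets (PiM UNIV (\<lambda>_. borel :: ('n \<Rightarrow> real) measure))"
    unfolding coeffs_measure_def by (rule sets_PiM_cong) (auto simp: sets_coeff_measure)
  then show ?thesis by (simp add: sets_PiM_equal_borel)
qed

lemma space_coeffs_measure: "space (coeffs_measure :: 'n::finite coeffs measure) = UNIV"
  using sets_eq_imp_space_eq[OF sets_coeffs_measure] by simp

lemma space_coeff_measure: "space (coeff_measure :: ('n::finite \<Rightarrow> real) measure) = UNIV"
  using sets_eq_imp_space_eq[OF sets_coeff_measure] by simp

text \<open>The coordinates of a coefficient are independent, so the one-dimensional bounds
  multiply. The shift \<open>w\<close> stands for everything in an increment that the resampled
  coefficient does not influence.\<close>

lemma coeff_measure_box_le: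
  fixes c w :: "'n::finite \<Rightarrow> real"
  assumes g: "1 \<le> g" "g \<le> 2" and \<rho>: "\<rho> \<ge> 0" and a: "a > 0"
  shows "emeasure coeff_measure {u. \<forall>m. \<bar>a * tri (u m * g + c m) + w m\<bar> \<le> \<rho>}
    \<le> ennreal ((12 * \<rho> / a) ^ CARD('n))"
proof -
  interpret unif: prob_space unif by (rule prob_space_unif)
  interpret P: product_sigma_finite "\<lambda>_::'n. unif" by standard
  define B where "B m = {v. \<bar>a * tri (v * g + c m) + w m\<bar> \<le> \<rho>}" for m
  have "closed (B m)" for m
    unfolding B_def by (intro closed_Collect_le continuous_intros)
  then have meas: "B m \<in> sets unif" for m by simp
  have "emeasure unif (B m) \<le> ennreal (12 * \<rho> / a)" for m
  proof -
    have "emeasure unif (B m) = emeasure lborel ({0..1} \<inter> B m)"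
      using meas by (subst emeasure_uniform_measure) (auto simp: divide_ennreal_def)
    also have "{0..1} \<inter> B m = {v\<in>{0..1}. \<bar>tri (v * g + c m) - (- w m / a)\<bar> \<le> \<rho> / a}"
    proof -
      have "\<bar>t - (- w m / a)\<bar> \<le> \<rho> / a \<longleftrightarrow> \<bar>a * t + w m\<bar> \<le> \<rho>" for t
      proof -
        have "a * t + w m = a * (t - (- w m / a))" using a by (simp add: field_simps)
        then have "\<bar>a * t + w m\<bar> = a * \<bar>t - (- w m / a)\<bar>"
          using a by (simp only: abs_mult abs_of_pos)
        then show ?thesis using a by (simp add: field_simps)
      qed
      then show ?thesis by (auto simp: B_def)
    qed
    also have "emeasure lborel \<dots> \<le> ennreal (12 * (\<rho> / a))"
      using g \<rho> a by (intro emeasure_tri_sublevel) auto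
    finally show ?thesis by simp
  qed
  then have "(\<Prod>m\<in>(UNIV::'n set). emeasure unif (B m)) \<le> (\<Prod>m\<in>(UNIV::'n set). ennreal (12 * \<rho> / a))"
    by (intro prod_mono_ennreal) auto
  moreover have "{u. \<forall>m. \<bar>a * tri (u m * g + c m) + w m\<bar> \<le> \<rho>} = PiE UNIV B"
    by (auto simp: B_def PiE_def)
  moreover have "emeasure coeff_measure (PiE UNIV B) = (\<Prod>m\<in>(UNIV::'n set). emeasure unif (B m))"
    unfolding coeff_measure_def by (rule P.emeasure_PiM[OF finite meas])
  ultimately show ?thesis using a \<rho> by (simp add: ennreal_power)
qed

text \<open>Resampling the coordinate \<open>q\<close> preserves the product law. By Fubini, a
  conditional bound that is uniform in the other coordinates is a bound for the whole event.\<close>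

lemma emeasure_coeffs_fubini:
  assumes S: "S \<in> sets (coeffs_measure :: 'n::finite coeffs measure)"
    and bd: "\<And>\<omega>. emeasure coeff_measure {u. fun_upd \<omega> q u \<in> S} \<le> b"
  shows "emeasure coeffs_measure S \<le> b"
proof -
  let ?Q = "coeff_measure :: ('n \<Rightarrow> real) measure"
  let ?O = "coeffs_measure :: 'n coeffs measure"
  interpret Q: prob_space ?Q by (rule prob_space_coeff_measure)
  interpret O: prob_space ?O by (rule prob_space_coeffs_measure)
  interpret QO: pair_sigma_finite ?Q ?O by standard
  have d: "distr (?Q \<Otimes>\<^sub>M ?O) ?O (\<lambda>(u, \<omega>). fun_upd \<omega> q u) = ?O"
    using distr_pair_PiM_eq_PiM[of UNIV "\<lambda>_. ?Q" q] unfolding coeffs_measure_def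
    by (simp add: prob_space_coeff_measure)
  have meas: "(\<lambda>(u, \<omega>). fun_upd \<omega> q u) \<in> measurable (?Q \<Otimes>\<^sub>M ?O) ?O"
    unfolding coeffs_measure_def
  proof (rule measurable_PiM_single')
    fix j :: "nat \<times> nat"
    let ?P = "?Q \<Otimes>\<^sub>M PiM UNIV (\<lambda>_::nat \<times> nat. ?Q)"
    have "(\<lambda>x. snd x j) \<in> measurable ?P ?Q"
      by (rule measurable_compose[OF measurable_snd measurable_component_singleton]) simp
    moreover have "(\<lambda>x. (case x of (u, \<omega>::'n coeffs) \<Rightarrow> fun_upd \<omega> q u) j) = (if j = q then fst else (\<lambda>x. snd x j))"
      by (auto simp: fun_eq_iff)
    ultimately show "(\<lambda>x. (case x of (u, \<omega>) \<Rightarrow> fun_upd \<omega> q u) j) \<in> measurable ?P ?Q" by (cases "j = q") auto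
  qed (auto simp: space_coeff_measure)
  let ?A = "(\<lambda>(u, \<omega>). fun_upd \<omega> q u) -` S \<inter> space (?Q \<Otimes>\<^sub>M ?O)"
  have "emeasure ?O S = emeasure (distr (?Q \<Otimes>\<^sub>M ?O) ?O (\<lambda>(u, \<omega>). fun_upd \<omega> q u)) S" by (simp add: d)
  also have "\<dots> = emeasure (?Q \<Otimes>\<^sub>M ?O) ?A" by (rule emeasure_distr[OF meas S])
  also have "\<dots> = (\<integral>\<^sup>+ \<omega>. emeasure ?Q ((\<lambda>u. (u, \<omega>)) -` ?A) \<partial>?O)"
    by (rule QO.emeasure_pair_measure_alt2) (rule measurable_sets[OF meas S])
  also have "\<dots> \<le> (\<integral>\<^sup>+ \<omega>. b \<partial>?O)"
  proof (rule nn_integral_mono)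
    fix \<omega>
    have "(\<lambda>u. (u, \<omega>)) -` ?A = {u. fun_upd \<omega> q u \<in> S}"
      by (auto simp: space_pair_measure space_coeff_measure space_coeffs_measure)
    then show "emeasure ?Q ((\<lambda>u. (u, \<omega>)) -` ?A) \<le> b" using bd by simp
  qed
  also have "\<dots> = b" by (simp add: O.emeasure_space_1)
  finally show ?thesis .
qed

text \<open>A net point within \<open>r k / 4\<close> of \<open>x\<close> has a bump that lies
  between 1 and 2 at \<open>x\<close> and vanishes at \<open>y\<close>. Resampling its coefficient
  therefore moves the value at \<open>x\<close> only, through a single triangle wave of amplitude
  \<open>amp k\<close>.\<close>

lemma rfun_small_ball:
  fixes v :: "'n::finite \<Rightarrow> real" and p :: "nat \<Rightarrow> nat \<Rightarrow> 'a::metric_space"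
  assumes r: "\<And>k. r k > 0" and net: "\<And>k x. \<exists>i<N k. dist x (p k i) \<le> r k / 4"
    and sep: "r k < dist x y" and \<rho>: "\<rho> \<ge> 0"
  shows "emeasure coeffs_measure {\<omega>. \<forall>m. \<bar>(rfun r N p \<omega> x - rfun r N p \<omega> y) $ m + v m\<bar> \<le> \<rho>}
    \<le> ennreal ((12 * \<rho> / amp k) ^ CARD('n))"
proof -
  obtain i where i: "i < N k" "dist x (p k i) \<le> r k / 4" using net by blast
  define g where "g = bump (r k) (p k i) x"
  have g: "1 \<le> g" "g \<le> 2" using i(2) r[of k] bump_bounds[OF r[of k]]
    by (auto simp: g_def bump_def field_simps)
  have "dist y (p k i) \<ge> r k / 2"
    using dist_triangle[of x y "p k i"] sep i(2) r[of k] by (simp add: dist_commute)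
  then have gy: "bump (r k) (p k i) y = 0" using r[of k] by (simp add: bump_def field_simps)
  define S where "S = {\<omega>. \<forall>m. \<bar>(rfun r N p \<omega> x - rfun r N p \<omega> y) $ m + v m\<bar> \<le> \<rho>}"
  have ev: "continuous_on UNIV (\<lambda>\<omega>::'n coeffs. apply_bcontfun (rfun r N p \<omega>) z)" for z
  proof -
    have "continuous_on UNIV (\<lambda>f::'a \<Rightarrow>\<^sub>C (real^'n). apply_bcontfun f z)"
      by (rule continuous_on_eval_bcontfun)
    then show ?thesis by (rule continuous_on_compose2[OF _ continuous_on_rfun[OF r]]) auto
  qed
  have "closed S"
    unfolding S_def by (intro closed_Collect_all closed_Collect_le continuous_intros ev)
  then have S: "S \<in> sets coeffs_measure" by (simp add: sets_coeffs_measure)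
  show ?thesis unfolding S_def[symmetric]
  proof (rule emeasure_coeffs_fubini[OF S, of "(k,i)"])
    fix \<omega> :: "'n coeffs"
    \<comment> \<open>\<open>c\<close> collects the other bumps of level \<open>k\<close> at
      \<open>x\<close>; \<open>w\<close> collects the other waves at \<open>x\<close>, the whole
      value at \<open>y\<close> and the shift \<open>v\<close>. Neither depends on the resampled
      coefficient.\<close>
    define c where "c m = (\<Sum>j\<in>{..<N k} - {i}. \<omega> (k,j) m * bump (r k) (p k j) x)" for m
    define w where "w m = (rfun r N p \<omega> x - rfun r N p \<omega> y - amp k *\<^sub>R wave r N p k \<omega> x) $ m + v m" for m
    have px: "phase r N p k (fun_upd \<omega> (k,i) u) x m = u m * g + c m" for u m
      unfolding phase_def c_def g_def using i(1) by (subst sum.remove[of _ i]) (auto intro!: sum.cong)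
    have py: "phase r N p k (fun_upd \<omega> (k,i) u) y m = phase r N p k \<omega> y m" for u m
      unfolding phase_def by (rule sum.cong) (auto simp: gy)
    have wy: "apply_bcontfun (wave r N p k (fun_upd \<omega> (k,i) u)) y = wave r N p k \<omega> y" for u
      by (simp add: wave_apply[OF r] py)
    have "(rfun r N p (fun_upd \<omega> (k,i) u) x - rfun r N p (fun_upd \<omega> (k,i) u) y) $ m + v m =
        amp k * tri (u m * g + c m) + w m" for u m
    proof -
      have up: "rfun r N p (fun_upd \<omega> (k,i) u) z = rfun r N p \<omega> z +
          amp k *\<^sub>R (wave r N p k (fun_upd \<omega> (k,i) u) z - wave r N p k \<omega> z)" for z
        using arg_cong[OF rfun_upd[OF r, where N=N and p=p and \<omega>=\<omega> and k=k and i=i and u=u], of "\<lambda>f. apply_bcontfun f z"]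
        by (simp add: algebra_simps)
      show ?thesis unfolding up wy w_def by (simp add: wave_apply[OF r] px algebra_simps)
    qed
    then have "{u. fun_upd \<omega> (k,i) u \<in> S} = {u. \<forall>m. \<bar>amp k * tri (u m * g + c m) + w m\<bar> \<le> \<rho>}"
      by (simp add: S_def)
    then show "emeasure coeff_measure {u. fun_upd \<omega> (k,i) u \<in> S} \<le> ennreal ((12 * \<rho> / amp k) ^ CARD('n))"
      using coeff_measure_box_le[OF g \<rho> amp_pos] by simp
  qed
qed

section \<open>Energies and Hausdorff measures of graphs\<close>

text \<open>A dyadic form of the \<open>t\<close>-energy of the lift of \<open>\<mu>\<close> to the
  graph: for positive \<open>t\<close>, summing \<open>2 powr (t * j)\<close> over the scales that
  contain a pair is comparable, at distances up to 1, to the kernel with exponent \<open>-t\<close>.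
  The cut-off \<open>J\<close> keeps the diagonal finite.\<close>

definition energy :: "real \<Rightarrow> nat \<Rightarrow> 'a::metric_space set \<Rightarrow> ('a \<Rightarrow> real) \<Rightarrow> ('a \<Rightarrow>\<^sub>C (real^'n::finite)) \<Rightarrow> real" where
  "energy t J X \<mu> f = (\<Sum>j\<le>J. \<Sum>x\<in>X. \<Sum>y\<in>X. 2 powr (t * real j) * (\<mu> x * \<mu> y) *
     of_bool (dist x y \<le> (1/2)^j \<and> (\<forall>m. \<bar>(f x - f y) $ m\<bar> \<le> (1/2)^j)))"

lemma dyadic_scale:
  fixes \<rho> :: real
  assumes "0 < \<rho>" "\<rho> \<le> 1"
  obtains j where "(1/2)^(Suc j) < \<rho>" "\<rho> \<le> (1/2)^j"
proof -
  obtain n where n: "(1/2::real)^n < \<rho>" using assms(1) real_arch_pow_inv[of \<rho> "1/2"] by auto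
  define k where "k = (LEAST k. (1/2::real)^k < \<rho>)"
  have k: "(1/2)^k < \<rho>" unfolding k_def by (rule LeastI[of "\<lambda>k. (1/2::real)^k < \<rho>", OF n])
  have "k \<noteq> 0" using k assms by (intro notI) simp
  then obtain j where j: "k = Suc j" by (cases k) auto
  have "\<not> (1/2)^j < \<rho>" using not_less_Least[of j "\<lambda>k. (1/2::real)^k < \<rho>"] j k_def by simp
  then show ?thesis using that[of j] k j by simp
qed

lemma sum_UN_le:
  fixes g :: "'a \<Rightarrow> real"
  assumes "finite F" "\<And>i. i \<in> F \<Longrightarrow> finite (A i)" "\<And>x. g x \<ge> 0"
  shows "sum g (\<Union>i\<in>F. A i) \<le> (\<Sum>i\<in>F. sum g (A i))"
  using assms(1,2)
proof (induction F)
  case (insert i F)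
  have "sum g (A i \<union> (\<Union>i\<in>F. A i)) \<le> sum g (A i) + sum g (\<Union>i\<in>F. A i)"
    using insert sum_Un[of "A i" "\<Union>i\<in>F. A i" g] sum_nonneg[of "A i \<inter> (\<Union>i\<in>F. A i)" g] assms(3) by simp
  then show ?case using insert by simp
qed simp

text \<open>Points of low potential carry at least half of the mass, and a covering ball that
  contains such a point has mass at most a constant times \<open>\<rho> i powr s\<close>. A cover
  with a small sum thus captures too little mass. Compactness makes the cover finite, so
  \<open>J\<close> can be chosen beyond all of its scales and the measure of one level
  \<open>J\<close> suffices.\<close>

lemma energy_bound_imp_hausdorff_measure_nonzero:
  fixes f :: "'a::metric_space \<Rightarrow>\<^sub>C (real^'n::finite)"
  assumes cpt: "compact (UNIV :: 'a set)" and s: "0 < s" "s \<le> t" and c: "c > 0"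
    and fin: "\<And>J. finite (X J)" and \<mu>: "\<And>J x. \<mu> J x \<ge> 0" and mass: "\<And>J. c \<le> sum (\<mu> J) (X J)"
    and en: "\<exists>\<^sub>F J in sequentially. energy t J (X J) (\<mu> J) f \<le> C"
  shows "hausdorff_measure s (graph f) \<noteq> 0"
proof
  assume null: "hausdorff_measure s (graph f) = 0"
  define C' where "C' = max C 1"
  have C': "C' > 0" "C \<le> C'" by (auto simp: C'_def)
  \<comment> \<open>The first entry yields \<open>4 * \<rho> i \<le> 1\<close>, so that exponents
    \<open>t\<close> and \<open>s\<close> can be compared; the second bounds the captured mass by
    \<open>c/4\<close>, below the \<open>c/2\<close> of low potential.\<close>
  define \<eta> where "\<eta> = min ((1/4) powr s) (c\<^sup>2 / (8 * C' * 4 powr s))"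
  have \<eta>: "\<eta> > 0" using c C' by (simp add: \<eta>_def)
  obtain z \<rho> where cov: "\<And>i::nat. 0 \<le> \<rho> i" "graph f \<subseteq> (\<Union>i. ball (z i) (\<rho> i))"
    "(\<Sum>i. ennreal (\<rho> i powr s)) \<le> ennreal \<eta>"
    using hausdorff_null_imp_ball_cover[OF null s(1) \<eta>] by blast
  have "compact (graph f)"
    unfolding graph_def
    by (rule compact_continuous_image[OF _ cpt]) (intro continuous_intros continuous_on_apply_bcontfun)
  then obtain F0 where F0: "finite F0" "graph f \<subseteq> (\<Union>i\<in>F0. ball (z i) (\<rho> i))"
    using cov(2) compactE_image[of "graph f" UNIV "\<lambda>i. ball (z i) (\<rho> i)"] by auto
  define F where "F = {i\<in>F0. \<rho> i > 0}"
  have F: "finite F" using F0 by (simp add: F_def)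
  have Fpos: "\<rho> i > 0" if "i \<in> F" for i using that by (simp add: F_def)
  have Fcov: "\<exists>i\<in>F. (x, f x) \<in> ball (z i) (\<rho> i)" for x
  proof -
    have "(x, f x) \<in> graph f" by (simp add: graph_def)
    then obtain i where "i \<in> F0" "(x, f x) \<in> ball (z i) (\<rho> i)" using F0(2) by blast
    moreover then have "\<rho> i > 0" by (metis ball_empty empty_iff not_le)
    ultimately show ?thesis unfolding F_def by blast
  qed
  have Fsum: "(\<Sum>i\<in>F. \<rho> i powr s) \<le> \<eta>"
  proof -
    have "ennreal (\<Sum>i\<in>F. \<rho> i powr s) = (\<Sum>i\<in>F. ennreal (\<rho> i powr s))" by simp
    also have "\<dots> \<le> (\<Sum>i. ennreal (\<rho> i powr s))" by (rule sum_le_suminf) (auto simp: F summableI)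
    also have "\<dots> \<le> ennreal \<eta>" by (rule cov(3))
    finally show ?thesis using \<eta> by (subst (asm) ennreal_le_iff) auto
  qed
  have small: "4 * \<rho> i \<le> 1" if "i \<in> F" for i
  proof -
    have "\<rho> i powr s \<le> (\<Sum>i\<in>F. \<rho> i powr s)" using that F by (intro member_le_sum) auto
    then have "\<rho> i powr s \<le> (1/4) powr s" using Fsum by (simp add: \<eta>_def)
    then have "\<rho> i \<le> 1/4" using s Fpos[OF that] powr_less_mono2[of s "1/4" "\<rho> i"] by force
    then show ?thesis by simp
  qed
  have "\<forall>i\<in>F. \<exists>j. (1/2)^(Suc j) < 2 * \<rho> i \<and> 2 * \<rho> i \<le> (1/2)^j"
  proof
    fix i assume i: "i \<in> F"
    show "\<exists>j. (1/2)^(Suc j) < 2 * \<rho> i \<and> 2 * \<rho> i \<le> (1/2)^j"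
      using dyadic_scale[of "2 * \<rho> i"] Fpos[OF i] small[OF i] by auto
  qed
  \<comment> \<open>\<open>jj i\<close> is the dyadic scale of the diameter bound
    \<open>2 * \<rho> i\<close>: any two graph points in the ball are close at this scale, while its
    length is below \<open>4 * \<rho> i\<close>.\<close>
  then obtain jj where jj: "\<And>i. i \<in> F \<Longrightarrow> (1/2)^(Suc (jj i)) < 2 * \<rho> i"
      "\<And>i. i \<in> F \<Longrightarrow> 2 * \<rho> i \<le> (1/2)^(jj i)" by metis
  obtain J where J: "J \<ge> Max (insert 0 (jj ` F))" "energy t J (X J) (\<mu> J) f \<le> C"
    using en unfolding frequently_sequentially by blast
  have jJ: "jj i \<le> J" if "i \<in> F" for i using J(1) that F by (subst (asm) Max_le_iff) auto
  define near where "near j x y \<longleftrightarrow> dist x y \<le> (1/2)^j \<and> (\<forall>m. \<bar>(f x - f y) $ m\<bar> \<le> (1/2)^j)" for j x y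
  \<comment> \<open>The truncated potential of the lifted measure; the energy is its
    integral.\<close>
  define V where "V x = (\<Sum>j\<le>J. \<Sum>y\<in>X J. 2 powr (t * real j) * \<mu> J y * of_bool (near j x y))" for x
  have en_V: "energy t J (X J) (\<mu> J) f = (\<Sum>x\<in>X J. \<mu> J x * V x)"
    unfolding energy_def V_def near_def[symmetric] sum_distrib_left
    by (subst sum.swap) (simp add: mult_ac)
  have V0: "V x \<ge> 0" for x unfolding V_def by (intro sum_nonneg) (simp add: \<mu>)
  \<comment> \<open>Markov's inequality: points above this threshold carry at most mass
    \<open>c/2\<close>.\<close>
  define G where "G = {x\<in>X J. V x \<le> 2 * C' / c}"
  have "sum (\<mu> J) (X J - G) * (2 * C' / c) \<le> (\<Sum>x\<in>X J - G. \<mu> J x * V x)"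
    unfolding sum_distrib_right by (intro sum_mono mult_left_mono) (auto simp: G_def \<mu>)
  also have "\<dots> \<le> (\<Sum>x\<in>X J. \<mu> J x * V x)"
    using fin by (intro sum_mono2) (auto simp: V0 \<mu>)
  also have "\<dots> \<le> C'" using J(2) C'(2) unfolding en_V by simp
  finally have "sum (\<mu> J) (X J - G) \<le> c / 2" using C' c by (simp add: field_simps)
  moreover have "sum (\<mu> J) (X J) = sum (\<mu> J) G + sum (\<mu> J) (X J - G)"
    using fin by (metis (no_types, lifting) G_def add.commute mem_Collect_eq subsetI sum.subset_diff)
  ultimately have Gmass: "c / 2 \<le> sum (\<mu> J) G" using mass[of J] by simp
  define A where "A i = {x\<in>X J. (x, f x) \<in> ball (z i) (\<rho> i)}" for i
  have Abound: "sum (\<mu> J) (A i \<inter> G) \<le> 2 * C' / c * (4 powr s * \<rho> i powr s)" if i: "i \<in> F" for i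
  proof (cases "A i \<inter> G = {}")
    case True
    then show ?thesis using C' c by simp
  next
    case False
    then obtain x where x: "x \<in> A i" "x \<in> G" by auto
    have nr: "near (jj i) x y" if y: "y \<in> A i" for y
    proof -
      have "dist (x, f x) (y, f y) < 2 * \<rho> i"
        using x(1) y dist_triangle_half_r[of "z i" "(x, f x)" "2 * \<rho> i" "(y, f y)"]
        by (simp add: A_def dist_commute)
      then have d: "dist (x, f x) (y, f y) \<le> (1/2)^(jj i)" using jj(2)[OF i] by simp
      have "dist x y \<le> dist (x, f x) (y, f y)" using dist_fst_le[of "(x, f x)" "(y, f y)"] by simp
      moreover have "\<bar>(f x - f y) $ m\<bar> \<le> dist (x, f x) (y, f y)" for m
        using component_le_norm_cart[of "f x - f y" m] dist_snd_le[of "(x, f x)" "(y, f y)"]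
        by (simp add: dist_norm)
      ultimately show ?thesis unfolding near_def using d by (meson order_trans)
    qed
    \<comment> \<open>The term of scale \<open>jj i\<close> alone, among those making up the
      potential at \<open>x\<close>, already controls the mass of the ball.\<close>
    have "2 powr (t * real (jj i)) * sum (\<mu> J) (A i) = (\<Sum>y\<in>A i. 2 powr (t * real (jj i)) * \<mu> J y * of_bool (near (jj i) x y))"
      by (simp add: nr sum_distrib_left)
    also have "\<dots> \<le> (\<Sum>y\<in>X J. 2 powr (t * real (jj i)) * \<mu> J y * of_bool (near (jj i) x y))"
      using fin by (intro sum_mono2) (auto simp: A_def \<mu>)
    also have "\<dots> \<le> V x"
      unfolding V_def using jJ[OF i]
      by (intro member_le_sum[where f="\<lambda>j. \<Sum>y\<in>X J. 2 powr (t * real j) * \<mu> J y * of_bool (near j x y)"])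
         (auto intro!: sum_nonneg simp: \<mu>)
    also have "\<dots> \<le> 2 * C' / c" using x(2) by (simp add: G_def)
    finally have "2 powr (t * real (jj i)) * sum (\<mu> J) (A i) \<le> 2 * C' / c" .
    then have "sum (\<mu> J) (A i) \<le> (2 * C' / c) / 2 powr (t * real (jj i))"
      by (subst pos_le_divide_eq) (simp_all add: mult.commute)
    then have "sum (\<mu> J) (A i) \<le> 2 * C' / c * 2 powr (- (t * real (jj i)))"
      by (simp add: powr_minus divide_inverse)
    moreover have "2 powr (- (t * real (jj i))) = ((1/2)^jj i) powr t"
    proof -
      have "(1/2::real)^jj i = 2 powr (- real (jj i))"
        by (simp add: powr_minus powr_realpow power_one_over inverse_eq_divide)
      then show ?thesis by (simp add: powr_powr mult.commute)
    qed
    moreover have "((1/2)^jj i) powr t \<le> (4 * \<rho> i) powr t"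
      using jj(1)[OF i] s by (intro powr_mono2) auto
    moreover have "(4 * \<rho> i) powr t \<le> (4 * \<rho> i) powr s"
      using small[OF i] Fpos[OF i] s by (intro powr_mono') auto
    moreover have "(4 * \<rho> i) powr s = 4 powr s * \<rho> i powr s" using Fpos[OF i] by (simp add: powr_mult)
    ultimately have le: "2 powr (- (t * real (jj i))) \<le> 4 powr s * \<rho> i powr s"
      and "sum (\<mu> J) (A i) \<le> 2 * C' / c * 2 powr (- (t * real (jj i)))" by linarith+
    note this(2)
    also have "2 * C' / c * 2 powr (- (t * real (jj i))) \<le> 2 * C' / c * (4 powr s * \<rho> i powr s)"
      using C' c by (intro mult_left_mono le) auto
    finally have "sum (\<mu> J) (A i) \<le> 2 * C' / c * (4 powr s * \<rho> i powr s)" .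
    moreover have "sum (\<mu> J) (A i \<inter> G) \<le> sum (\<mu> J) (A i)"
      using fin[of J] by (intro sum_mono2) (auto simp: A_def \<mu>)
    ultimately show ?thesis by linarith
  qed
  have "G \<subseteq> (\<Union>i\<in>F. A i \<inter> G)" using Fcov by (auto simp: A_def G_def)
  then have "sum (\<mu> J) G \<le> sum (\<mu> J) (\<Union>i\<in>F. A i \<inter> G)"
    using fin[of J] F by (intro sum_mono2) (auto simp: A_def \<mu>)
  also have "\<dots> \<le> (\<Sum>i\<in>F. sum (\<mu> J) (A i \<inter> G))"
    using fin[of J] F by (intro sum_UN_le) (auto simp: A_def \<mu>)
  also have "\<dots> \<le> (\<Sum>i\<in>F. 2 * C' / c * (4 powr s * \<rho> i powr s))" by (intro sum_mono Abound)
  also have "\<dots> = 2 * C' / c * 4 powr s * (\<Sum>i\<in>F. \<rho> i powr s)"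
    unfolding sum_distrib_left by (intro sum.cong refl) simp
  also have "\<dots> \<le> 2 * C' / c * 4 powr s * (c\<^sup>2 / (8 * C' * 4 powr s))"
    using Fsum C' c by (intro mult_left_mono) (auto simp: \<eta>_def)
  also have "\<dots> = c / 4" using C' c by (simp add: power2_eq_square)
  finally show False using Gmass c by simp
qed

section \<open>Expected energy of the random function\<close>

lemma borel_energy [measurable]:
  "(\<lambda>f :: 'a::metric_space \<Rightarrow>\<^sub>C (real^'n::finite). energy t J X \<mu> f) \<in> borel_measurable borel"
proof -
  have "closed {f :: 'a \<Rightarrow>\<^sub>C (real^'n). \<forall>m. \<bar>(f x - f y) $ m\<bar> \<le> (1/2)^j}" for x y :: 'a and j :: nat
    by (intro closed_Collect_all closed_Collect_le continuous_intros continuous_on_eval_bcontfun)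
  then have meas: "{f :: 'a \<Rightarrow>\<^sub>C (real^'n). \<forall>m. \<bar>(f x - f y) $ m\<bar> \<le> (1/2)^j} \<in> sets borel" for x y :: 'a and j :: nat
    by simp
  have eq: "energy t J X \<mu> f = (\<Sum>j\<le>J. \<Sum>x\<in>X. \<Sum>y\<in>X. 2 powr (t * real j) * (\<mu> x * \<mu> y) * of_bool (dist x y \<le> (1/2)^j) *
     indicator {f :: 'a \<Rightarrow>\<^sub>C (real^'n). \<forall>m. \<bar>(f x - f y) $ m\<bar> \<le> (1/2)^j} f)" for f :: "'a \<Rightarrow>\<^sub>C (real^'n)"
    unfolding energy_def by (intro sum.cong refl) (auto simp: indicator_def)
  show ?thesis
    unfolding eq
    by (intro borel_measurable_sum borel_measurable_times borel_measurable_const borel_measurable_indicator meas)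
qed

lemma measurable_rfun:
  fixes p :: "nat \<Rightarrow> nat \<Rightarrow> 'a::metric_space"
  assumes r: "\<And>k. r k > 0"
  shows "rfun r N p \<in> measurable (coeffs_measure :: 'n::finite coeffs measure) borel"
proof -
  have "rfun r N p \<in> borel_measurable (borel :: 'n coeffs measure)"
    by (rule borel_measurable_continuous_onI[OF continuous_on_rfun[OF r]])
  then show ?thesis using measurable_cong_sets[OF sets_coeffs_measure refl] by blast
qed

text \<open>
  Pairs with \<open>lev x y < n\<close> are handled by the small ball estimate at scale \<open>lev x y\<close>; the remaining pairs,
  in particular the diagonal, only by the bound \<open>1\<close> for probabilities, which is affordable since
  \<open>w n\<close> may be chosen after \<open>J\<close>.
\<close>

lemma expected_energy_le:
  fixes g :: "'a::metric_space \<Rightarrow>\<^sub>C (real^'n::finite)" and lev :: "'a \<Rightarrow> 'a \<Rightarrow> nat"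
  assumes r: "\<And>k. r k > 0" and net: "\<And>k x. \<exists>i<N k. dist x (p k i) \<le> r k / 4"
    and X: "finite X" and \<mu>: "\<And>x. \<mu> x \<ge> 0" and mass: "sum \<mu> X \<le> 1"
    and lev: "\<And>x y. x \<in> X \<Longrightarrow> y \<in> X \<Longrightarrow> lev x y \<le> n"
    and sep: "\<And>x y. x \<in> X \<Longrightarrow> y \<in> X \<Longrightarrow> lev x y < n \<Longrightarrow> r (lev x y) < dist x y"
    and w: "\<And>x k. x \<in> X \<Longrightarrow> k \<le> n \<Longrightarrow> sum \<mu> {y\<in>X. lev x y = k} \<le> w k"
    and S: "\<And>x y. x \<in> X \<Longrightarrow> y \<in> X \<Longrightarrow> lev x y < n \<Longrightarrow>
       (\<Sum>j | j \<le> J \<and> dist x y \<le> (1/2)^j. 2 powr ((t - real CARD('n)) * real j)) \<le> S (lev x y)"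
    and S0: "\<And>k. S k \<ge> 0"
    and near: "(\<Sum>j\<le>J. 2 powr (t * real j)) * w n \<le> 1"
    and total: "(\<Sum>k<n. (12 / amp k) ^ CARD('n) * S k * w k) \<le> C"
    and C: "C \<ge> 0"
  shows "(\<integral>\<^sup>+\<omega>. ennreal (energy t J X \<mu> (rfun r N p \<omega> + g)) \<partial>coeffs_measure) \<le> ennreal (C + 1)"
proof -
  let ?d = "CARD('n)"
  let ?O = "coeffs_measure :: 'n coeffs measure"
  interpret O: prob_space ?O by (rule prob_space_coeffs_measure)
  define q where "q j x y = (if lev x y < n then (12 * (1/2)^j / amp (lev x y)) ^ ?d else 1)" for j :: nat and x y
  define B where "B j x y = {\<omega> :: 'n coeffs. \<forall>m. \<bar>((rfun r N p \<omega> + g) x - (rfun r N p \<omega> + g) y) $ m\<bar> \<le> (1/2)^j}" for j :: nat and x y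
  have q0: "q j x y \<ge> 0" for j x y using amp_pos by (simp add: q_def less_imp_le)
  have Bq: "emeasure ?O (B j x y) \<le> ennreal (q j x y)" if "x \<in> X" "y \<in> X" for j x y
  proof (cases "lev x y < n")
    case True
    have "B j x y = {\<omega>. \<forall>m. \<bar>(rfun r N p \<omega> x - rfun r N p \<omega> y) $ m + (g x - g y) $ m\<bar> \<le> (1/2)^j}"
      unfolding B_def by (simp add: algebra_simps)
    then show ?thesis
      using rfun_small_ball[where r=r and N=N and p=p, OF r net sep[OF that True], of "(1/2)^j" "\<lambda>m. (g x - g y) $ m"] True
      by (simp add: q_def)
  next
    case False
    then show ?thesis using O.emeasure_le_1 by (simp add: q_def)
  qed
  have Bm: "B j x y \<in> sets ?O" for j x y
  proof -
    have "closed {f :: 'a \<Rightarrow>\<^sub>C (real^'n). \<forall>m. \<bar>((f + g) x - (f + g) y) $ m\<bar> \<le> (1/2)^j}"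
      unfolding plus_bcontfun.rep_eq
      by (intro closed_Collect_all closed_Collect_le continuous_intros continuous_on_eval_bcontfun)
    then have "rfun r N p -` {f :: 'a \<Rightarrow>\<^sub>C (real^'n). \<forall>m. \<bar>((f + g) x - (f + g) y) $ m\<bar> \<le> (1/2)^j} \<inter> space ?O \<in> sets ?O"
      by (intro measurable_sets[OF measurable_rfun[OF r]]) simp
    then show ?thesis unfolding B_def space_coeffs_measure by (simp add: vimage_def)
  qed
  define a where "a j x y = 2 powr (t * real j) * (\<mu> x * \<mu> y) * of_bool (dist x y \<le> (1/2)^j)" for j :: nat and x y
  have a0: "a j x y \<ge> 0" for j x y by (simp add: a_def \<mu>)
  have "ennreal (energy t J X \<mu> (rfun r N p \<omega> + g)) =
     (\<Sum>j\<le>J. \<Sum>x\<in>X. \<Sum>y\<in>X. ennreal (a j x y) * indicator (B j x y) \<omega>)" for \<omega>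
  proof -
    have "energy t J X \<mu> (rfun r N p \<omega> + g) = (\<Sum>j\<le>J. \<Sum>x\<in>X. \<Sum>y\<in>X. a j x y * indicator (B j x y) \<omega>)"
      unfolding energy_def a_def by (intro sum.cong refl) (auto simp: indicator_def B_def)
    then show ?thesis
      by (simp add: sum_ennreal[symmetric] sum_nonneg a0 ennreal_mult ennreal_indicator)
  qed
  then have "(\<integral>\<^sup>+\<omega>. ennreal (energy t J X \<mu> (rfun r N p \<omega> + g)) \<partial>?O) =
     (\<Sum>j\<le>J. \<Sum>x\<in>X. \<Sum>y\<in>X. ennreal (a j x y) * emeasure ?O (B j x y))"
    using Bm by (simp add: nn_integral_sum nn_integral_cmult_indicator)
  also have "\<dots> \<le> (\<Sum>j\<le>J. \<Sum>x\<in>X. \<Sum>y\<in>X. ennreal (a j x y) * ennreal (q j x y))"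
    by (intro sum_mono mult_left_mono Bq) auto
  also have "\<dots> = ennreal (\<Sum>j\<le>J. \<Sum>x\<in>X. \<Sum>y\<in>X. a j x y * q j x y)"
    by (simp add: sum_ennreal[symmetric] sum_nonneg a0 q0 ennreal_mult)
  also have "\<dots> \<le> ennreal (C + 1)"
  proof (rule ennreal_leI)
    \<comment> \<open>Bounds the sum over all scales for a pair by a quantity that depends on its
      level only, so that the points \<open>y\<close> can be grouped by level. The value at
      \<open>n\<close> is absorbed by \<open>near\<close>, the others by
      \<open>total\<close>.\<close>
    define E where "E k = (if k < n then (12 / amp k) ^ ?d * S k else (\<Sum>j\<le>J. 2 powr (t * real j)))" for k
    have E: "(\<Sum>j\<le>J. 2 powr (t * real j) * of_bool (dist x y \<le> (1/2)^j) * q j x y) \<le> E (lev x y)"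
      if xy: "x \<in> X" "y \<in> X" for x y
    proof (cases "lev x y < n")
      case False
      then show ?thesis by (auto simp: E_def q_def intro!: sum_mono2)
    next
      case True
      have "(\<Sum>j\<le>J. 2 powr (t * real j) * of_bool (dist x y \<le> (1/2)^j) * q j x y) =
        (\<Sum>j\<le>J. (12 / amp (lev x y)) ^ ?d * (2 powr ((t - real ?d) * real j) * of_bool (dist x y \<le> (1/2)^j)))"
      proof (rule sum.cong[OF refl])
        fix j
        \<comment> \<open>The \<open>?d\<close>-th power of the radius in the small ball estimate
          lowers the exponent from \<open>t\<close> to \<open>t - ?d\<close>.\<close>
        have "2 powr ((t - real ?d) * real j) = 2 powr (t * real j) * ((1/2)^j)^?d"
        proof -
          have "2 powr ((t - real ?d) * real j) = 2 powr (t * real j) * 2 powr (- real (j * ?d))"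
            by (simp add: powr_add[symmetric] algebra_simps)
          also have "2 powr (- real (j * ?d)) = (1/2::real)^(j * ?d)"
            by (simp only: powr_minus powr_realpow zero_less_numeral) (simp add: power_one_over inverse_eq_divide)
          finally show ?thesis by (simp add: power_mult)
        qed
        then show "2 powr (t * real j) * of_bool (dist x y \<le> (1/2)^j) * q j x y =
           (12 / amp (lev x y)) ^ ?d * (2 powr ((t - real ?d) * real j) * of_bool (dist x y \<le> (1/2)^j))"
          using True by (simp add: q_def power_mult_distrib power_divide mult_ac)
      qed
      also have "\<dots> = (12 / amp (lev x y)) ^ ?d * (\<Sum>j | j \<le> J \<and> dist x y \<le> (1/2)^j. 2 powr ((t - real ?d) * real j))"
      proof -
        have "(\<Sum>j\<le>J. 2 powr ((t - real ?d) * real j) * of_bool (dist x y \<le> (1/2)^j)) =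
          (\<Sum>j | j \<le> J \<and> dist x y \<le> (1/2)^j. 2 powr ((t - real ?d) * real j))"
          by (rule sum.mono_neutral_cong_right) auto
        then show ?thesis by (simp only: sum_distrib_left[symmetric])
      qed
      also have "\<dots> \<le> (12 / amp (lev x y)) ^ ?d * S (lev x y)"
        using amp_pos[of "lev x y"] by (intro mult_left_mono S[OF xy True]) simp
      finally show ?thesis using True by (simp add: E_def)
    qed
    have E0: "E k \<ge> 0" for k using amp_pos[of k] S0 by (auto simp: E_def intro!: mult_nonneg_nonneg sum_nonneg)
    have "(\<Sum>j\<le>J. \<Sum>x\<in>X. \<Sum>y\<in>X. a j x y * q j x y) =
       (\<Sum>x\<in>X. \<mu> x * (\<Sum>y\<in>X. \<mu> y * (\<Sum>j\<le>J. 2 powr (t * real j) * of_bool (dist x y \<le> (1/2)^j) * q j x y)))"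
      unfolding a_def sum_distrib_left
      by (subst sum.swap, rule sum.cong[OF refl], subst sum.swap) (simp add: mult_ac)
    also have "\<dots> \<le> (\<Sum>x\<in>X. \<mu> x * (C + 1))"
    proof (intro sum_mono mult_left_mono \<mu>)
      fix x assume x: "x \<in> X"
      have "(\<Sum>y\<in>X. \<mu> y * (\<Sum>j\<le>J. 2 powr (t * real j) * of_bool (dist x y \<le> (1/2)^j) * q j x y)) \<le>
        (\<Sum>y\<in>X. \<mu> y * E (lev x y))"
        by (intro sum_mono mult_left_mono E x \<mu>) auto
      also have "\<dots> = (\<Sum>k\<le>n. \<Sum>y\<in>{y\<in>X. lev x y = k}. \<mu> y * E (lev x y))"
        using X lev[OF x] by (intro sum.group[symmetric]) auto
      also have "\<dots> = (\<Sum>k\<le>n. E k * sum \<mu> {y\<in>X. lev x y = k})"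
        by (intro sum.cong refl) (simp add: sum_distrib_left mult.commute)
      also have "\<dots> \<le> (\<Sum>k\<le>n. E k * w k)"
        using x by (intro sum_mono mult_left_mono w E0) auto
      also have "\<dots> = (\<Sum>k<n. (12 / amp k) ^ ?d * S k * w k) + (\<Sum>j\<le>J. 2 powr (t * real j)) * w n"
        by (simp add: lessThan_Suc_atMost[symmetric] E_def)
      also have "\<dots> \<le> C + 1" using near total by simp
      finally show "(\<Sum>y\<in>X. \<mu> y * (\<Sum>j\<le>J. 2 powr (t * real j) * of_bool (dist x y \<le> (1/2)^j) * q j x y)) \<le> C + 1" .
    qed
    also have "\<dots> = sum \<mu> X * (C + 1)" by (simp add: sum_distrib_right)
    also have "\<dots> \<le> 1 * (C + 1)"
    proof (cases "X = {}")
      case False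
      then obtain x where x: "x \<in> X" by auto
      have "0 \<le> w k" if "k \<le> n" for k using w[OF x that] sum_nonneg[of "{y\<in>X. lev x y = k}" \<mu>] \<mu> by force
      then have "0 \<le> (\<Sum>k<n. (12 / amp k) ^ ?d * S k * w k)"
        using amp_pos S0 by (intro sum_nonneg mult_nonneg_nonneg) (auto simp: less_imp_le)
      then show ?thesis using mass total by (intro mult_right_mono) auto
    qed (use C in simp)
    finally show "(\<Sum>j\<le>J. \<Sum>x\<in>X. \<Sum>y\<in>X. a j x y * q j x y) \<le> C + 1" by simp
  qed
  finally show ?thesis .
qed

section \<open>Finite nets and prevalence of finite lower energy limits\<close>

lemma compact_nets:
  fixes r :: "nat \<Rightarrow> real"
  assumes cpt: "compact (UNIV :: 'a::metric_space set)" and r: "\<And>k. r k > 0"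
  shows "\<exists>(N :: nat \<Rightarrow> nat) p. \<forall>k. \<forall>x::'a. \<exists>i<N k. dist x (p k i) \<le> r k"
proof -
  have "\<exists>(n::nat) q. \<forall>x::'a. \<exists>i<n. dist x (q i) \<le> r k" for k
  proof -
    have "(UNIV::'a set) \<subseteq> (\<Union>x\<in>UNIV. ball x (r k))"
      using r[of k] by (metis UN_I UNIV_I centre_in_ball subsetI)
    then obtain F where F: "finite F" "(UNIV::'a set) \<subseteq> (\<Union>x\<in>F. ball x (r k))"
      using compactE_image[OF cpt, of UNIV "\<lambda>x. ball x (r k)"] by (metis open_ball)
    have "\<exists>i<card F. dist x (from_nat_into F i) \<le> r k" for x
    proof -
      have "x \<in> (\<Union>x\<in>F. ball x (r k))" using F(2) by blast
      then obtain y where y: "y \<in> F" "dist y x < r k" by auto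
      obtain i where "i < card F" "y = from_nat_into F i"
        using y(1) bij_betw_from_nat_into_finite[OF F(1)] unfolding bij_betw_def by auto
      then show ?thesis using y(2) by (auto simp: dist_commute)
    qed
    then show ?thesis by blast
  qed
  then show ?thesis by metis
qed

text \<open>The law of \<open>rfun\<close> witnesses shyness: translating the exceptional set by
  \<open>h\<close> amounts to taking \<open>g = - h\<close> in the energy bound. Fatou's lemma makes
  the lower limit integrable, hence almost surely finite. Countability of \<open>T\<close> gives a
  common null set and keeps the set Borel.\<close>

lemma prevalent_finite_energy:
  fixes p :: "nat \<Rightarrow> nat \<Rightarrow> 'a::metric_space"
    and X :: "real \<Rightarrow> nat \<Rightarrow> 'a set" and \<mu> :: "real \<Rightarrow> nat \<Rightarrow> 'a \<Rightarrow> real"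
  assumes r: "\<And>k. r k > 0" and T: "countable T"
    and bd: "\<And>t J (g :: 'a \<Rightarrow>\<^sub>C (real^'n::finite)). t \<in> T \<Longrightarrow>
      (\<integral>\<^sup>+\<omega>. ennreal (energy t J (X t J) (\<mu> t J) (rfun r N p \<omega> + g)) \<partial>coeffs_measure) \<le> ennreal (C t)"
  shows "prevalent {f :: 'a \<Rightarrow>\<^sub>C (real^'n). \<forall>t\<in>T. liminf (\<lambda>J. ennreal (energy t J (X t J) (\<mu> t J) f)) < \<infinity>}"
    (is "prevalent ?P")
proof -
  let ?O = "coeffs_measure :: 'n coeffs measure"
  interpret O: prob_space ?O by (rule prob_space_coeffs_measure)
  have L[measurable]: "(\<lambda>f. liminf (\<lambda>J. ennreal (energy t J (X t J) (\<mu> t J) f))) \<in> borel_measurable borel"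
    for t by measurable
  have "?P = (\<Inter>t\<in>T. {f. liminf (\<lambda>J. ennreal (energy t J (X t J) (\<mu> t J) f)) < \<infinity>})" by auto
  moreover have "{f :: 'a \<Rightarrow>\<^sub>C (real^'n). liminf (\<lambda>J. ennreal (energy t J (X t J) (\<mu> t J) f)) < \<infinity>} \<in> sets borel" for t
    using L[of t] by measurable
  then have "(\<Inter>t\<in>T. {f :: 'a \<Rightarrow>\<^sub>C (real^'n). liminf (\<lambda>J. ennreal (energy t J (X t J) (\<mu> t J) f)) < \<infinity>}) \<in> sets borel"
    using T by (cases "T = {}") (auto intro!: sets.countable_INT'')
  ultimately have P: "?P \<in> sets borel" by simp
  define M where "M = distr ?O (borel :: ('a \<Rightarrow>\<^sub>C (real^'n)) measure) (rfun r N p)"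
  have M: "prob_space M" unfolding M_def by (rule O.prob_space_distr[OF measurable_rfun[OF r]])
  have "emeasure M ((\<lambda>b. b + h) ` (- ?P)) = 0" for h
  proof -
    have sh: "(\<lambda>f. f + (- h)) \<in> borel_measurable (borel :: ('a \<Rightarrow>\<^sub>C (real^'n)) measure)"
      by (intro borel_measurable_continuous_onI continuous_intros)
    have im: "(\<lambda>b. b + h) ` (- ?P) = (\<lambda>f. f + (- h)) -` (- ?P)"
    proof (intro set_eqI iffI)
      fix f assume "f \<in> (\<lambda>f. f + (- h)) -` (- ?P)"
      then have "f + (- h) \<in> - ?P" by (rule vimageD)
      then have "(f + (- h)) + h \<in> (\<lambda>b. b + h) ` (- ?P)" by (rule imageI)
      then show "f \<in> (\<lambda>b. b + h) ` (- ?P)" by simp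
    next
      fix f assume "f \<in> (\<lambda>b. b + h) ` (- ?P)"
      then obtain b where b: "b \<in> - ?P" "f = b + h" by (rule imageE)
      then have "f + (- h) = b" by simp
      then show "f \<in> (\<lambda>f. f + (- h)) -` (- ?P)" using b(1) by (simp only: vimage_eq)
    qed
    have mim: "(\<lambda>f. f + (- h)) -` (- ?P) \<in> sets borel"
      using measurable_sets[OF sh, of "- ?P"] P by simp
    have mm: "(\<lambda>\<omega>. rfun r N p \<omega> + (- h)) \<in> measurable ?O borel"
      by (rule measurable_compose[OF measurable_rfun[OF r] sh])
    have "AE \<omega> in ?O. liminf (\<lambda>J. ennreal (energy t J (X t J) (\<mu> t J) (rfun r N p \<omega> + (- h)))) \<noteq> \<infinity>"
      if t: "t \<in> T" for t
    proof (rule nn_integral_PInf_AE)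
      show "(\<lambda>\<omega>. liminf (\<lambda>J. ennreal (energy t J (X t J) (\<mu> t J) (rfun r N p \<omega> + (- h))))) \<in> borel_measurable ?O"
        by (rule measurable_compose[OF mm L])
      have "(\<integral>\<^sup>+\<omega>. liminf (\<lambda>J. ennreal (energy t J (X t J) (\<mu> t J) (rfun r N p \<omega> + (- h)))) \<partial>?O) \<le>
        liminf (\<lambda>J. \<integral>\<^sup>+\<omega>. ennreal (energy t J (X t J) (\<mu> t J) (rfun r N p \<omega> + (- h))) \<partial>?O)"
        by (rule nn_integral_liminf) (rule measurable_compose[OF mm], measurable)
      also have "\<dots> \<le> limsup (\<lambda>J. \<integral>\<^sup>+\<omega>. ennreal (energy t J (X t J) (\<mu> t J) (rfun r N p \<omega> + (- h))) \<partial>?O)"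
        by (rule Liminf_le_Limsup) simp
      also have "\<dots> \<le> ennreal (C t)"
        by (rule Limsup_bounded) (intro always_eventually allI bd t)
      finally show "(\<integral>\<^sup>+\<omega>. liminf (\<lambda>J. ennreal (energy t J (X t J) (\<mu> t J) (rfun r N p \<omega> + (- h)))) \<partial>?O) \<noteq> \<infinity>"
        using ennreal_less_top[of "C t"] by (metis infinity_ennreal_def leD)
    qed
    then have "AE \<omega> in ?O. \<forall>t\<in>T. liminf (\<lambda>J. ennreal (energy t J (X t J) (\<mu> t J) (rfun r N p \<omega> + (- h)))) \<noteq> \<infinity>"
      by (subst AE_ball_countable[OF T]) blast
    then have ae: "AE \<omega> in ?O. \<not> rfun r N p \<omega> + (- h) \<in> - ?P"
      by (rule AE_mp) (auto simp: top.not_eq_extremum)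
    have "emeasure M ((\<lambda>b. b + h) ` (- ?P)) = emeasure ?O (rfun r N p -` ((\<lambda>f. f + (- h)) -` (- ?P)) \<inter> space ?O)"
      unfolding M_def im by (rule emeasure_distr[OF measurable_rfun[OF r] mim])
    also have "\<dots> = 0"
    proof (subst AE_iff_measurable[symmetric])
      show "rfun r N p -` ((\<lambda>f. f + (- h)) -` (- ?P)) \<inter> space ?O \<in> sets ?O"
        by (rule measurable_sets[OF measurable_rfun[OF r] mim])
      show "{\<omega>\<in>space ?O. \<not> (\<not> rfun r N p \<omega> + (- h) \<in> - ?P)} =
          rfun r N p -` ((\<lambda>f. f + (- h)) -` (- ?P)) \<inter> space ?O" by blast
    qed (rule ae)
    finally show ?thesis .
  qed
  moreover have "- ?P \<in> sets borel" using P by auto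
  moreover have "sets M = sets borel" by (simp add: M_def)
  ultimately show ?thesis unfolding prevalent_def shy_def using M by blast
qed

section \<open>Frostman measures on finite nets\<close>

text \<open>
  Points are added one at a time, each with the largest weight that violates no constraint;
  constraints that are already tight stay tight.
\<close>

lemma maximal_weights:
  fixes A :: "'i \<Rightarrow> 'a set" and w :: "'i \<Rightarrow> real"
  assumes I: "finite I" and w: "\<And>c. c \<in> I \<Longrightarrow> w c \<ge> 0" and X: "finite X" "X \<subseteq> (\<Union>c\<in>I. A c)"
  shows "\<exists>\<mu>. (\<forall>x. \<mu> x \<ge> 0) \<and> (\<forall>c\<in>I. sum \<mu> (X \<inter> A c) \<le> w c) \<and>
     (\<forall>x\<in>X. \<exists>c\<in>I. x \<in> A c \<and> sum \<mu> (X \<inter> A c) = w c)"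
  using X
proof (induction X)
  case empty
  show ?case by (intro exI[of _ "\<lambda>_. 0"]) (auto simp: w)
next
  case (insert x X)
  have "X \<subseteq> (\<Union>c\<in>I. A c)" using insert.prems by simp
  from insert.IH[OF this] obtain \<mu> where \<mu>: "\<And>x. \<mu> x \<ge> 0" "\<And>c. c \<in> I \<Longrightarrow> sum \<mu> (X \<inter> A c) \<le> w c"
     "\<And>x. x \<in> X \<Longrightarrow> \<exists>c\<in>I. x \<in> A c \<and> sum \<mu> (X \<inter> A c) = w c" by blast
  define K where "K = {c\<in>I. x \<in> A c}"
  have K: "finite K" "K \<noteq> {}" using I insert.prems by (auto simp: K_def)
  define sl where "sl c = w c - sum \<mu> (X \<inter> A c)" for c
  define a where "a = Min (sl ` K)"
  have a0: "a \<ge> 0" unfolding a_def using K by (subst Min_ge_iff) (auto simp: K_def sl_def \<mu>(2))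
  have ale: "a \<le> sl c" if "c \<in> K" for c unfolding a_def using K that by (intro Min_le) auto
  have "a \<in> sl ` K" unfolding a_def using K by (intro Min_in) auto
  then obtain c0 where c0: "c0 \<in> K" "a = sl c0" by (metis imageE)
  define \<mu>' where "\<mu>' y = (if y = x then a else \<mu> y)" for y
  have sum': "sum \<mu>' (insert x X \<inter> A c) = sum \<mu> (X \<inter> A c) + (if x \<in> A c then a else 0)" for c
  proof -
    have "sum \<mu>' (X \<inter> A c) = sum \<mu> (X \<inter> A c)"
      by (rule sum.cong) (use insert.hyps in \<open>auto simp: \<mu>'_def\<close>)
    moreover have "insert x X \<inter> A c = (if x \<in> A c then insert x (X \<inter> A c) else X \<inter> A c)" by auto
    ultimately show ?thesis using insert.hyps by (auto simp: \<mu>'_def)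
  qed
  show ?case
  proof (intro exI[of _ \<mu>'] conjI ballI allI)
    show "\<mu>' y \<ge> 0" for y using \<mu>(1) a0 by (simp add: \<mu>'_def)
    show "sum \<mu>' (insert x X \<inter> A c) \<le> w c" if "c \<in> I" for c
      using \<mu>(2)[OF that] ale[of c] that by (auto simp: sum' K_def sl_def simp del: Int_insert_left_if0 Int_insert_left_if1)
    fix y assume y: "y \<in> insert x X"
    show "\<exists>c\<in>I. y \<in> A c \<and> sum \<mu>' (insert x X \<inter> A c) = w c"
    proof (cases "y = x")
      case True
      then show ?thesis using c0 by (intro bexI[of _ c0]) (auto simp: sum' K_def sl_def simp del: Int_insert_left_if0 Int_insert_left_if1)
    next
      case False
      then obtain c where c: "c \<in> I" "y \<in> A c" "sum \<mu> (X \<inter> A c) = w c" using y \<mu>(3) by auto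
      \<comment> \<open>The slack of a tight constraint is 0; if it contains \<open>x\<close>, the
        new weight is 0.\<close>
      have "(if x \<in> A c then a else 0) = 0" using ale[of c] a0 c by (auto simp: K_def sl_def)
      then show ?thesis using c by (intro bexI[of _ c]) (auto simp: sum' simp del: Int_insert_left_if0 Int_insert_left_if1)
    qed
  qed
qed

text \<open>Greedy selection: take an index of largest \<open>r\<close>, discard everything that
  meets its set, and continue with the rest. A discarded set meets one selected no later, whose
  \<open>r\<close> is at least as large.\<close>

lemma finite_vitali:
  fixes A :: "'i \<Rightarrow> 'a set" and r :: "'i \<Rightarrow> real"
  assumes "finite I" "\<And>i. i \<in> I \<Longrightarrow> A i \<noteq> {}"
  shows "\<exists>J\<subseteq>I. (\<forall>i\<in>J. \<forall>j\<in>J. i \<noteq> j \<longrightarrow> A i \<inter> A j = {}) \<and>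
     (\<forall>i\<in>I. \<exists>j\<in>J. A i \<inter> A j \<noteq> {} \<and> r i \<le> r j)"
  using assms
proof (induction I rule: finite_psubset_induct)
  case (psubset I)
  show ?case
  proof (cases "I = {}")
    case False
    have "Max (r ` I) \<in> r ` I" using psubset.hyps False by (intro Max_in) auto
    then obtain m where m: "m \<in> I" "r m = Max (r ` I)" by (metis imageE)
    have mmax: "r i \<le> r m" if "i \<in> I" for i unfolding m(2) using psubset.hyps that by (intro Max_ge) auto
    define I' where "I' = {i\<in>I. A i \<inter> A m = {}}"
    have "I' \<subset> I" using m(1) psubset.prems[OF m(1)] by (auto simp: I'_def)
    moreover have "A i \<noteq> {}" if "i \<in> I'" for i using that psubset.prems by (auto simp: I'_def)
    ultimately obtain J' where J': "J' \<subseteq> I'" "\<forall>i\<in>J'. \<forall>j\<in>J'. i \<noteq> j \<longrightarrow> A i \<inter> A j = {}"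
      "\<forall>i\<in>I'. \<exists>j\<in>J'. A i \<inter> A j \<noteq> {} \<and> r i \<le> r j" using psubset.IH[of I'] by blast
    show ?thesis
    proof (intro exI[of _ "insert m J'"] conjI)
      show "insert m J' \<subseteq> I" using J'(1) m(1) by (auto simp: I'_def)
      show "\<forall>i\<in>insert m J'. \<forall>j\<in>insert m J'. i \<noteq> j \<longrightarrow> A i \<inter> A j = {}"
        using J'(1,2) unfolding I'_def by blast
      show "\<forall>i\<in>I. \<exists>j\<in>insert m J'. A i \<inter> A j \<noteq> {} \<and> r i \<le> r j"
      proof
        fix i assume i: "i \<in> I"
        show "\<exists>j\<in>insert m J'. A i \<inter> A j \<noteq> {} \<and> r i \<le> r j"
          using i J'(3) mmax[OF i] by (cases "i \<in> I'") (auto simp: I'_def)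
      qed
    qed
  qed simp
qed

lemma finite_net:
  assumes cpt: "compact (UNIV :: 'a::metric_space set)" and r: "r > 0"
  shows "\<exists>X. finite X \<and> (\<forall>p::'a. \<exists>x\<in>X. dist p x \<le> r)"
proof -
  obtain N and p :: "nat \<Rightarrow> nat \<Rightarrow> 'a" where np: "\<And>k x. \<exists>i<N k. dist x (p k i) \<le> r"
    using compact_nets[OF cpt, of "\<lambda>_. r"] r by blast
  show ?thesis
  proof (intro exI[of _ "p 0 ` {..<N 0}"] conjI allI)
    show "\<exists>x\<in>p 0 ` {..<N 0}. dist q x \<le> r" for q using np[of 0 q] by auto
  qed simp
qed

text \<open>The contrapositive of the null criterion gives one lower bound for all countable ball
  covers; a finite cover becomes countable by padding with radius 0.\<close>

lemma finite_cover_content: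
  assumes s: "s > 0" and pos: "hausdorff_measure s (UNIV :: 'a::metric_space set) \<noteq> 0"
  shows "\<exists>\<eta>>0. \<forall>(F::'i set) (z::'i \<Rightarrow> 'a) \<rho>. finite F \<longrightarrow> (\<forall>i\<in>F. 0 \<le> \<rho> i) \<longrightarrow>
    UNIV = (\<Union>i\<in>F. ball (z i) (\<rho> i)) \<longrightarrow> \<eta> < (\<Sum>i\<in>F. \<rho> i powr s)"
proof -
  obtain \<eta> where \<eta>: "\<eta> > 0" and no: "\<And>z \<rho>. (\<forall>i::nat. 0 \<le> \<rho> i) \<Longrightarrow> (UNIV::'a set) \<subseteq> (\<Union>i. ball (z i) (\<rho> i)) \<Longrightarrow>
      \<not> (\<Sum>i. ennreal (\<rho> i powr s)) \<le> ennreal \<eta>"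
    using ball_covers_imp_hausdorff_null[OF s, of "UNIV :: 'a set"] pos by blast
  have key: "\<eta> < (\<Sum>i\<in>F. \<rho> i powr s)"
    if F: "finite F" "\<And>i. i \<in> F \<Longrightarrow> 0 \<le> \<rho> i" "UNIV = (\<Union>i\<in>F. ball (z i) (\<rho> i))"
    for F :: "'i set" and z :: "'i \<Rightarrow> 'a" and \<rho>
  proof -
    define e where "e = from_nat_into F"
    have e: "bij_betw e {..<card F} F" unfolding e_def by (rule bij_betw_from_nat_into_finite[OF F(1)])
    define r where "r i = (if i < card F then \<rho> (e i) else 0)" for i
    have r0: "\<forall>i. 0 \<le> r i" using F(2) bij_betwE[OF e] by (auto simp: r_def)
    have "(UNIV::'a set) \<subseteq> (\<Union>i. ball (z (e i)) (r i))"
    proof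
      fix x :: 'a
      have "x \<in> (\<Union>i\<in>F. ball (z i) (\<rho> i))" using F(3) by blast
      then obtain f where f: "f \<in> F" "x \<in> ball (z f) (\<rho> f)" by blast
      have "f \<in> e ` {..<card F}" using e f(1) by (simp add: bij_betw_def)
      then obtain i where i: "i < card F" "e i = f" by (metis imageE lessThan_iff)
      then have "x \<in> ball (z (e i)) (r i)" using f(2) by (simp add: r_def)
      then show "x \<in> (\<Union>i. ball (z (e i)) (r i))" by blast
    qed
    from no[OF r0 this] have "ennreal \<eta> < (\<Sum>i. ennreal (r i powr s))" by simp
    also have "\<dots> = (\<Sum>i<card F. ennreal (r i powr s))"
      by (rule suminf_finite) (auto simp: r_def)
    also have "\<dots> = ennreal (\<Sum>i<card F. r i powr s)" by simp
    also have "(\<Sum>i<card F. r i powr s) = (\<Sum>i<card F. \<rho> (e i) powr s)" by (rule sum.cong) (auto simp: r_def)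
    also have "\<dots> = (\<Sum>f\<in>F. \<rho> f powr s)" by (rule sum.reindex_bij_betw[OF e])
    finally show ?thesis using \<eta> by (simp add: ennreal_less_iff)
  qed
  show ?thesis
  proof (intro exI[of _ \<eta>] conjI allI impI \<eta>)
    show "\<eta> < (\<Sum>i\<in>F. \<rho> i powr s)"
      if "finite F" "\<forall>i\<in>F. 0 \<le> \<rho> i" "UNIV = (\<Union>i\<in>F. ball (z i) (\<rho> i))"
      for F :: "'i set" and z :: "'i \<Rightarrow> 'a" and \<rho>
      by (rule key) (use that in auto)
  qed
qed

text \<open>With maximal weights on a net, either the total mass is 1 or every net point lies in a
  ball whose constraint is tight. In the latter case disjoint tight balls, enlarged five times,
  cover the space, so their masses add up to at least \<open>\<eta> / 5 powr s\<close>. This bound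
  does not depend on the fineness \<open>n\<close>.\<close>

lemma frostman_finite:
  assumes cpt: "compact (UNIV :: 'a::metric_space set)" and s: "s > 0"
    and pos: "hausdorff_measure s (UNIV :: 'a set) \<noteq> 0"
  shows "\<exists>c>0. \<forall>n. \<exists>(X::'a set) \<mu>. finite X \<and> (\<forall>x. \<mu> x \<ge> 0) \<and> c \<le> sum \<mu> X \<and> sum \<mu> X \<le> 1 \<and>
    (\<forall>x\<in>X. \<forall>k\<le>n. sum \<mu> {y\<in>X. dist x y \<le> (1/2)^k} \<le> ((1/2)^k) powr s)"
proof -
  obtain \<eta> where \<eta>: "\<eta> > 0" and cont: "\<forall>(F::('a \<times> nat) set) (z::'a \<times> nat \<Rightarrow> 'a) \<rho>. finite F \<longrightarrow>
      (\<forall>i\<in>F. 0 \<le> \<rho> i) \<longrightarrow> UNIV = (\<Union>i\<in>F. ball (z i) (\<rho> i)) \<longrightarrow> \<eta> < (\<Sum>i\<in>F. \<rho> i powr s)"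
    using finite_cover_content[OF s pos, where 'i="'a \<times> nat"] by (elim exE conjE)
  define c where "c = min 1 (\<eta> / 5 powr s)"
  have c0: "c > 0" using \<eta> by (simp add: c_def)
  have "\<exists>(X::'a set) \<mu>. finite X \<and> (\<forall>x. \<mu> x \<ge> 0) \<and> c \<le> sum \<mu> X \<and> sum \<mu> X \<le> 1 \<and>
    (\<forall>x\<in>X. \<forall>k\<le>n. sum \<mu> {y\<in>X. dist x y \<le> (1/2)^k} \<le> ((1/2)^k) powr s)" for n
  proof -
    obtain X :: "'a set" where X: "finite X" "\<And>p. \<exists>x\<in>X. dist p x \<le> (1/2)^n"
      using finite_net[OF cpt, of "(1/2)^n"] by auto
    \<comment> \<open>\<open>None\<close> encodes the constraint on the total mass,
      \<open>Some (x, k)\<close> the one on a closed ball about a net point.\<close>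
    define A where "A o' = (case o' of None \<Rightarrow> UNIV | Some (x, k) \<Rightarrow> cball x ((1/2)^k))" for o' :: "('a \<times> nat) option"
    define w where "w o' = (case o' of None \<Rightarrow> 1 | Some (x, k) \<Rightarrow> ((1/2)^k) powr s)" for o' :: "('a \<times> nat) option"
    define I where "I = insert None (Some ` (X \<times> {..n}))"
    obtain \<mu> where \<mu>: "\<And>x. \<mu> x \<ge> 0" "\<And>o'. o' \<in> I \<Longrightarrow> sum \<mu> (X \<inter> A o') \<le> w o'"
      "\<And>x. x \<in> X \<Longrightarrow> \<exists>o'\<in>I. x \<in> A o' \<and> sum \<mu> (X \<inter> A o') = w o'"
    proof -
      have "\<exists>\<mu>. (\<forall>x. \<mu> x \<ge> 0) \<and> (\<forall>c\<in>I. sum \<mu> (X \<inter> A c) \<le> w c) \<and>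
         (\<forall>x\<in>X. \<exists>c\<in>I. x \<in> A c \<and> sum \<mu> (X \<inter> A c) = w c)"
        by (rule maximal_weights) (use X in \<open>auto simp: I_def w_def A_def split: option.split\<close>)
      then show ?thesis using that by blast
    qed
    have le1: "sum \<mu> X \<le> 1" using \<mu>(2)[of None] by (simp add: I_def A_def w_def)
    have ball_le: "sum \<mu> {y\<in>X. dist x y \<le> (1/2)^k} \<le> ((1/2)^k) powr s" if "x \<in> X" "k \<le> n" for x k
    proof -
      have "X \<inter> A (Some (x, k)) = {y\<in>X. dist x y \<le> (1/2)^k}" by (auto simp: A_def)
      moreover have "Some (x, k) \<in> I" using that by (simp add: I_def)
      ultimately show ?thesis using \<mu>(2)[of "Some (x, k)"] by (simp add: w_def)
    qed
    have "c \<le> sum \<mu> X"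
    proof (cases "sum \<mu> X = 1")
      case True then show ?thesis by (simp add: c_def)
    next
      case False
      define I1 where "I1 = {(z, k). z \<in> X \<and> k \<le> n \<and> sum \<mu> (X \<inter> cball z ((1/2)^k)) = ((1/2)^k) powr s}"
      have I1: "finite I1" by (rule finite_subset[of _ "X \<times> {..n}"]) (use X in \<open>auto simp: I1_def\<close>)
      \<comment> \<open>Selection is applied to traces on \<open>X\<close>: their disjointness
        suffices for adding masses, and each contains its own centre.\<close>
      define B where "B i = X \<inter> cball (fst i) ((1/2)^(snd i))" for i :: "'a \<times> nat"
      define r where "r i = (1/2::real)^(snd i)" for i :: "'a \<times> nat"
      have "\<exists>J\<subseteq>I1. (\<forall>i\<in>J. \<forall>j\<in>J. i \<noteq> j \<longrightarrow> B i \<inter> B j = {}) \<and>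
         (\<forall>i\<in>I1. \<exists>j\<in>J. B i \<inter> B j \<noteq> {} \<and> r i \<le> r j)"
        by (rule finite_vitali[OF I1]) (auto simp: I1_def B_def)
      then obtain J where J: "J \<subseteq> I1" "\<forall>i\<in>J. \<forall>j\<in>J. i \<noteq> j \<longrightarrow> B i \<inter> B j = {}"
        "\<forall>i\<in>I1. \<exists>j\<in>J. B i \<inter> B j \<noteq> {} \<and> r i \<le> r j" by (elim exE conjE)
      have finJ: "finite J" by (rule finite_subset[OF J(1) I1])
      have cov: "UNIV = (\<Union>i\<in>J. ball (fst i) (5 * r i))"
      proof (intro set_eqI iffI)
        fix p :: 'a
        obtain x where x: "x \<in> X" "dist p x \<le> (1/2)^n" using X(2) by blast
        obtain o' where o': "o' \<in> I" "x \<in> A o'" "sum \<mu> (X \<inter> A o') = w o'" using \<mu>(3)[OF x(1)] by blast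
        have "o' \<noteq> None"
        proof
          assume "o' = None"
          then show False using o'(3) False by (simp add: A_def w_def)
        qed
        then obtain z k where zk: "o' = Some (z, k)" "z \<in> X" "k \<le> n" using o'(1) by (auto simp: I_def)
        then have i1: "(z, k) \<in> I1" using o'(3) by (simp add: I1_def A_def w_def)
        obtain j where j: "j \<in> J" "B (z,k) \<inter> B j \<noteq> {}" "r (z,k) \<le> r j" using J(3) i1 by blast
        obtain u where u: "u \<in> B (z,k)" "u \<in> B j" using j(2) by blast
        have "(1/2)^n \<le> (1/2::real)^k" using zk(3) by (intro power_decreasing) auto
        moreover have "dist z x \<le> (1/2)^k" using o'(2) zk(1) by (simp add: A_def)
        moreover have "dist z u \<le> (1/2)^k" using u(1) by (simp add: B_def)
        moreover have "dist (fst j) u \<le> r j" using u(2) by (simp add: B_def r_def)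
        moreover have "(1/2)^k \<le> r j" using j(3) by (simp add: r_def)
        \<comment> \<open>Four steps of length at most \<open>r j\<close> lead from the selected
          centre to \<open>p\<close>; the factor 5 makes the inequality strict.\<close>
        moreover have "dist (fst j) p \<le> dist (fst j) u + dist z u + dist z x + dist p x"
          using dist_triangle[of "fst j" p u] dist_triangle[of u p z] dist_triangle[of z p x]
          by (simp add: dist_commute)
        moreover have "r j > 0" by (simp add: r_def)
        ultimately have "dist (fst j) p < 5 * r j" using x(2) by linarith
        then show "p \<in> (\<Union>i\<in>J. ball (fst i) (5 * r i))" using j(1) by auto
      qed simp
      have "\<eta> < (\<Sum>i\<in>J. (5 * r i) powr s)"
        by (rule cont[rule_format, OF finJ _ cov]) (simp add: r_def)
      also have "\<dots> = (\<Sum>i\<in>J. 5 powr s * sum \<mu> (B i))"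
      proof (rule sum.cong[OF refl])
        fix i assume "i \<in> J"
        then have "i \<in> I1" using J(1) by blast
        then have "sum \<mu> (B i) = r i powr s" by (auto simp: I1_def B_def r_def)
        then show "(5 * r i) powr s = 5 powr s * sum \<mu> (B i)" by (simp add: r_def powr_mult)
      qed
      also have "\<dots> = 5 powr s * (\<Sum>i\<in>J. sum \<mu> (B i))" by (simp add: sum_distrib_left)
      also have "(\<Sum>i\<in>J. sum \<mu> (B i)) = sum \<mu> (\<Union>i\<in>J. B i)"
        using X J(2) finJ by (intro sum.UNION_disjoint[symmetric]) (auto simp: B_def)
      also have "5 powr s * sum \<mu> (\<Union>i\<in>J. B i) \<le> 5 powr s * sum \<mu> X"
        using X \<mu>(1) by (intro mult_left_mono sum_mono2) (auto simp: B_def)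
      finally have "\<eta> / 5 powr s \<le> sum \<mu> X" by (simp add: field_simps)
      then show ?thesis by (simp add: c_def)
    qed
    then show ?thesis using X(1) \<mu>(1) le1 ball_le by blast
  qed
  then show ?thesis using c0 by blast
qed

text \<open>The polynomial factor stems from \<open>amp\<close> and from counting scales, the
  geometric one from the decay of the masses.\<close>

lemma summable_poly_geometric:
  fixes q :: real
  assumes q: "0 < q" "q < 1"
  shows "summable (\<lambda>k. real (Suc k) ^ p * q ^ k)"
proof -
  have "(\<lambda>k. real (Suc (Suc k)) / real (Suc k)) \<longlonglongrightarrow> 1"
    by real_asymp
  then have "(\<lambda>k. (real (Suc (Suc k)) / real (Suc k)) ^ p * q) \<longlonglongrightarrow> 1 ^ p * q"
    by (intro tendsto_intros)
  then have "\<forall>\<^sub>F k in sequentially. (real (Suc (Suc k)) / real (Suc k)) ^ p * q < (1 + q) / 2"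
    using q by (intro order_tendstoD(2)) auto
  then obtain N where N: "\<And>k. k \<ge> N \<Longrightarrow> (real (Suc (Suc k)) / real (Suc k)) ^ p * q < (1 + q) / 2"
    by (auto simp: eventually_sequentially)
  show ?thesis
  proof (rule summable_ratio_test[of "(1 + q) / 2" N])
    show "(1 + q) / 2 < 1" using q by simp
    fix k assume "N \<le> k"
    then have le: "(real (Suc (Suc k)) / real (Suc k)) ^ p * q \<le> (1 + q) / 2" using N[of k] by simp
    have "real (Suc (Suc k)) ^ p * q ^ Suc k = (real (Suc (Suc k)) / real (Suc k)) ^ p * q * (real (Suc k) ^ p * q ^ k)"
      by (simp add: power_divide)
    also have "\<dots> \<le> (1 + q) / 2 * (real (Suc k) ^ p * q ^ k)"
      using q by (intro mult_right_mono le) auto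
    finally show "norm (real (Suc (Suc k)) ^ p * q ^ Suc k) \<le> (1 + q) / 2 * norm (real (Suc k) ^ p * q ^ k)"
      using q by simp
  qed
qed

section \<open>Bounded expected energy\<close>

lemma half_power_powr: "((1/2::real)^k) powr s = 2 powr (- (s * real k))"
proof -
  have "(1/2::real)^k = 2 powr (- real k)"
    by (simp add: powr_minus powr_realpow power_one_over inverse_eq_divide)
  then show ?thesis by (simp add: powr_powr mult.commute)
qed

lemma inverse_amp_power: "(12 / amp k) ^ d = 12 ^ d * real (Suc k) ^ (2 * d)"
  unfolding amp_def by (simp only: divide_divide_eq_right div_by_1 power_mult_distrib power_mult)

text \<open>Treats both signs of the exponent \<open>u = t - d\<close> at once.\<close>

lemma geometric_factor_le:
  "2 powr (u * real j) \<le> 2 powr (max u 0 * real k)" if "j \<le> k" for u :: real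
  using that by (intro powr_mono) (auto simp: max_def mult_nonpos_nonneg intro: mult_left_mono)

text \<open>The points of level \<open>k\<close> around a given one have mass of order
  \<open>2 powr (- s * k)\<close>, and each pair costs \<open>2 powr (max (t - d) 0 * k)\<close> up
  to polynomial factors, with d the dimension of the target. As \<open>s\<close> exceeds
  \<open>max (t - d) 0\<close>, the sum over the levels converges.\<close>

lemma energy_family_of_positive_measure:
  fixes p :: "nat \<Rightarrow> nat \<Rightarrow> 'a::metric_space"
  assumes cpt: "compact (UNIV :: 'a set)" and s: "0 < s" "t - real CARD('n::finite) < s"
    and pos: "hausdorff_measure s (UNIV :: 'a set) \<noteq> 0"
    and net: "\<And>k x. \<exists>i<N k. dist x (p k i) \<le> (1/2)^k / 4"
  shows "\<exists>c>0. \<exists>C. \<forall>J. \<exists>X \<mu>. finite X \<and> (\<forall>x. 0 \<le> \<mu> x) \<and> c \<le> sum \<mu> X \<and>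
    (\<forall>g :: 'a \<Rightarrow>\<^sub>C (real^'n). (\<integral>\<^sup>+\<omega>. ennreal (energy t J X \<mu> (rfun (\<lambda>k. (1/2)^k) N p \<omega> + g)) \<partial>coeffs_measure) \<le> ennreal C)"
proof -
  let ?d = "CARD('n)"
  obtain c where c: "c > 0" and frost: "\<And>n. \<exists>(X::'a set) \<mu>. finite X \<and> (\<forall>x. \<mu> x \<ge> 0) \<and> c \<le> sum \<mu> X \<and> sum \<mu> X \<le> 1 \<and>
    (\<forall>x\<in>X. \<forall>k\<le>n. sum \<mu> {y\<in>X. dist x y \<le> (1/2)^k} \<le> ((1/2)^k) powr s)"
    using frostman_finite[OF cpt s(1) pos] by blast
  define \<sigma> where "\<sigma> = max (t - real ?d) 0"
  define q where "q = 2 powr (\<sigma> - s)"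
  have q: "0 < q" "q < 1" using s by (auto simp: q_def \<sigma>_def powr_less_one)
  \<comment> \<open>Level \<open>k\<close> only says that the distance is at most the previous
    scale, hence the factor \<open>2 powr s\<close>; for \<open>k = 0\<close> it also dominates the
    total mass 1.\<close>
  define w where "w k = 2 powr s * ((1/2)^k) powr s" for k :: nat
  \<comment> \<open>At most \<open>k\<close> scales contain a pair of level \<open>k\<close>, each
    with weight at most \<open>2 powr (\<sigma> * k)\<close>. In \<open>M\<close> the exponent
    \<open>2 * ?d + 1\<close> joins the loss from \<open>amp\<close> with this count.\<close>
  define S where "S k = real k * 2 powr (\<sigma> * real k)" for k :: nat
  define M where "M k = 12 ^ ?d * 2 powr s * (real (Suc k) ^ (2 * ?d + 1) * q ^ k)" for k
  have M_sum: "summable M" unfolding M_def by (intro summable_mult summable_poly_geometric q)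
  have M0: "M k \<ge> 0" for k using q by (simp add: M_def)
  have term_le: "(12 / amp k) ^ ?d * S k * w k \<le> M k" for k
  proof -
    have "2 powr (\<sigma> * real k) * 2 powr (- (s * real k)) = q ^ k"
      by (simp add: q_def powr_add[symmetric] powr_powr powr_realpow[symmetric] algebra_simps)
    then have "(12 / amp k) ^ ?d * S k * w k = 12 ^ ?d * 2 powr s * (real (Suc k) ^ (2 * ?d) * real k * q ^ k)"
      unfolding S_def w_def half_power_powr inverse_amp_power
      by (metis (no_types, opaque_lifting) mult.assoc mult.left_commute)
    also have "\<dots> \<le> M k"
      unfolding M_def using q by (intro mult_left_mono mult_right_mono) auto
    finally show ?thesis .
  qed
  have "\<exists>X \<mu>. finite X \<and> (\<forall>x. 0 \<le> \<mu> x) \<and> c \<le> sum \<mu> X \<and>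
    (\<forall>g :: 'a \<Rightarrow>\<^sub>C (real^'n). (\<integral>\<^sup>+\<omega>. ennreal (energy t J X \<mu> (rfun (\<lambda>k. (1/2)^k) N p \<omega> + g)) \<partial>coeffs_measure) \<le> ennreal (suminf M + 1))" for J
  proof -
    define T where "T = (\<Sum>j\<le>J. 2 powr (t * real j))"
    have T0: "T \<ge> 0" unfolding T_def by (intro sum_nonneg) simp
    have "(1/2) powr s < (1::real)" using s(1) powr_less_mono2[of s "1/2" 1] by simp
    \<comment> \<open>The depth is chosen after \<open>J\<close>, so that the mass at level
      \<open>n\<close> compensates the full weight \<open>T\<close> of all scales.\<close>
    then obtain n where n: "((1/2) powr s) ^ n < 1 / ((T + 1) * 2 powr s)"
      using real_arch_pow_inv[of "1 / ((T + 1) * 2 powr s)" "(1/2) powr s"] T0 by auto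
    have wn: "T * w n \<le> 1"
    proof -
      have "((1/2)^n) powr s = ((1/2::real) powr s) ^ n"
        unfolding half_power_powr by (simp add: powr_realpow[symmetric] powr_powr powr_divide powr_minus_divide)
      moreover have "((1/2) powr s) ^ n * ((T + 1) * 2 powr s) < 1"
        using n T0 by (subst (asm) pos_less_divide_eq) auto
      ultimately have "((1/2)^n) powr s * ((T + 1) * 2 powr s) \<le> 1" by simp
      moreover have "T * w n \<le> ((1/2)^n) powr s * ((T + 1) * 2 powr s)"
        unfolding w_def by (simp add: algebra_simps)
      ultimately show ?thesis by linarith
    qed
    obtain X :: "'a set" and \<mu> where X: "finite X" "\<forall>x. \<mu> x \<ge> 0" "c \<le> sum \<mu> X" "sum \<mu> X \<le> 1"
      and ball: "\<And>x k. x \<in> X \<Longrightarrow> k \<le> n \<Longrightarrow> sum \<mu> {y\<in>X. dist x y \<le> (1/2)^k} \<le> ((1/2)^k) powr s"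
      using frost[of n] by blast
    \<comment> \<open>The first scale that separates the two points, capped at \<open>n\<close>; the
      diagonal has level \<open>n\<close>.\<close>
    define lev where "lev x y = (LEAST k. (1/2)^k < dist x y \<or> k = n)" for x y :: 'a
    have lev_le: "lev x y \<le> n" for x y unfolding lev_def by (rule Least_le) simp
    have lev_sep: "(1/2)^(lev x y) < dist x y" if "lev x y < n" for x y
    proof -
      have "(1/2)^(lev x y) < dist x y \<or> lev x y = n" unfolding lev_def by (rule LeastI[of _ n]) simp
      then show ?thesis using that by simp
    qed
    have lev_near: "dist x y \<le> (1/2)^j" if "j < lev x y" for x y j
      using not_less_Least[of j "\<lambda>k. (1/2)^k < dist x y \<or> k = n"] that unfolding lev_def by simp
    have w_bd: "sum \<mu> {y\<in>X. lev x y = k} \<le> w k" if x: "x \<in> X" and k: "k \<le> n" for x k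
    proof (cases k)
      case 0
      have "sum \<mu> {y\<in>X. lev x y = k} \<le> sum \<mu> X" using X by (intro sum_mono2) auto
      also have "\<dots> \<le> w k" using X(4) s(1) 0 ge_one_powr_ge_zero[of 2 s] by (simp add: w_def)
      finally show ?thesis .
    next
      case (Suc k')
      have "sum \<mu> {y\<in>X. lev x y = k} \<le> sum \<mu> {y\<in>X. dist x y \<le> (1/2)^k'}"
        using X(1,2) lev_near[of k' x] Suc by (intro sum_mono2) auto
      also have "\<dots> \<le> ((1/2)^k') powr s" using ball[OF x, of k'] k Suc by simp
      also have "\<dots> = w k" unfolding w_def half_power_powr Suc
        by (simp add: powr_add[symmetric] algebra_simps)
      finally show ?thesis .
    qed
    have S_bd: "(\<Sum>j | j \<le> J \<and> dist x y \<le> (1/2)^j. 2 powr ((t - real ?d) * real j)) \<le> S (lev x y)"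
      if "lev x y < n" for x y
    proof -
      have sub: "{j. j \<le> J \<and> dist x y \<le> (1/2)^j} \<subseteq> {..<lev x y}"
      proof
        fix j assume j: "j \<in> {j. j \<le> J \<and> dist x y \<le> (1/2)^j}"
        have "\<not> lev x y \<le> j"
        proof
          assume "lev x y \<le> j"
          then have "(1/2::real)^j \<le> (1/2)^(lev x y)" by (intro power_decreasing) auto
          moreover have "dist x y \<le> (1/2)^j" using j by simp
          ultimately show False using lev_sep[OF that] by linarith
        qed
        then show "j \<in> {..<lev x y}" by simp
      qed
      have "(\<Sum>j | j \<le> J \<and> dist x y \<le> (1/2)^j. 2 powr ((t - real ?d) * real j)) \<le>
         (\<Sum>j<lev x y. 2 powr ((t - real ?d) * real j))"
        by (intro sum_mono2 sub) auto
      also have "\<dots> \<le> (\<Sum>j<lev x y. 2 powr (\<sigma> * real (lev x y)))"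
        unfolding \<sigma>_def by (intro sum_mono geometric_factor_le) auto
      also have "\<dots> = S (lev x y)" by (simp add: S_def)
      finally show ?thesis .
    qed
    have total: "(\<Sum>k<n. (12 / amp k) ^ ?d * S k * w k) \<le> suminf M"
    proof -
      have "(\<Sum>k<n. (12 / amp k) ^ ?d * S k * w k) \<le> (\<Sum>k<n. M k)" by (intro sum_mono term_le)
      also have "\<dots> \<le> suminf M" by (rule sum_le_suminf[OF M_sum]) (auto simp: M0)
      finally show ?thesis .
    qed
    have "(\<integral>\<^sup>+\<omega>. ennreal (energy t J X \<mu> (rfun (\<lambda>k. (1/2)^k) N p \<omega> + g)) \<partial>coeffs_measure) \<le> ennreal (suminf M + 1)"
      for g :: "'a \<Rightarrow>\<^sub>C (real^'n)"
    proof (rule expected_energy_le[where lev=lev and n=n and w=w and S=S])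
      show "0 \<le> suminf M" by (rule suminf_nonneg[OF M_sum M0])
      show "(\<Sum>j\<le>J. 2 powr (t * real j)) * w n \<le> 1" using wn unfolding T_def .
      show "0 \<le> S k" for k by (simp add: S_def)
    qed (use X lev_le lev_sep w_bd S_bd total net in auto)
    then show ?thesis using X by blast
  qed
  then show ?thesis using c by blast
qed

section \<open>Dimension zero: uniform measures on a Cantor tree\<close>

text \<open>A condensation point \<open>p\<close> exists by compactness. Since \<open>S\<close>
  without \<open>p\<close> is a countable union of sets at positive distance from \<open>p\<close>,
  one of these is uncountable, and so is a smaller ball about \<open>p\<close>.\<close>

lemma uncountable_split:
  fixes S :: "'a::metric_space set"
  assumes S: "compact S" "uncountable S"
  shows "\<exists>A B. A \<subseteq> S \<and> B \<subseteq> S \<and> compact A \<and> compact B \<and> uncountable A \<and> uncountable B \<and> A \<inter> B = {}"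
proof -
  have "\<exists>p\<in>S. \<forall>e>0. uncountable (S \<inter> cball p e)"
  proof (rule ccontr)
    assume "\<not> ?thesis"
    then have "\<forall>p\<in>S. \<exists>e>0. countable (S \<inter> cball p e)" by blast
    then obtain e where e: "\<And>p. p \<in> S \<Longrightarrow> e p > 0" "\<And>p. p \<in> S \<Longrightarrow> countable (S \<inter> cball p (e p))" by metis
    have "S \<subseteq> (\<Union>p\<in>S. ball p (e p))" using e(1) by force
    then obtain F where F: "F \<subseteq> S" "finite F" "S \<subseteq> (\<Union>p\<in>F. ball p (e p))"
      using compactE_image[OF S(1), of S "\<lambda>p. ball p (e p)"] by (metis open_ball)
    have "S \<subseteq> (\<Union>p\<in>F. S \<inter> cball p (e p))" using F(3) ball_subset_cball by blast
    moreover have "countable (\<Union>p\<in>F. S \<inter> cball p (e p))"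
      using F(1,2) e(2) by (intro countable_UN) (auto intro: countable_finite)
    ultimately show False using S(2) countable_subset by blast
  qed
  then obtain p where p: "p \<in> S" "\<And>e. e > 0 \<Longrightarrow> uncountable (S \<inter> cball p e)" by blast
  have "\<exists>n. uncountable (S \<inter> {x. 1 / real (Suc n) \<le> dist p x})"
  proof (rule ccontr)
    assume "\<not> ?thesis"
    then have "countable (\<Union>n. S \<inter> {x. 1 / real (Suc n) \<le> dist p x})" by (intro countable_UN) auto
    then have "countable (insert p (\<Union>n. S \<inter> {x. 1 / real (Suc n) \<le> dist p x}))" by simp
    moreover have "S \<subseteq> insert p (\<Union>n. S \<inter> {x. 1 / real (Suc n) \<le> dist p x})"
    proof
      fix x assume x: "x \<in> S"
      show "x \<in> insert p (\<Union>n. S \<inter> {x. 1 / real (Suc n) \<le> dist p x})"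
      proof (cases "x = p")
        case False
        then obtain n where "inverse (real (Suc n)) < dist p x" using reals_Archimedean[of "dist p x"] by auto
        then have "1 / real (Suc n) \<le> dist p x" by (simp add: inverse_eq_divide)
        then show ?thesis using x by blast
      qed simp
    qed
    ultimately show False using S(2) countable_subset by blast
  qed
  then obtain e where e: "e > 0" "uncountable (S \<inter> {x. e \<le> dist p x})"
    by (metis of_nat_0_less_iff zero_less_Suc zero_less_divide_1_iff)
  show ?thesis
  proof (intro exI conjI)
    show "S \<inter> {x. e \<le> dist p x} \<subseteq> S" "S \<inter> cball p (e/2) \<subseteq> S" by auto
    have "closed {x. e \<le> dist p x}" by (intro closed_Collect_le continuous_intros)
    then show "compact (S \<inter> {x. e \<le> dist p x})" by (rule compact_Int_closed[OF S(1)])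
    show "compact (S \<inter> cball p (e/2))" by (rule compact_Int_closed[OF S(1) closed_cball])
    show "uncountable (S \<inter> {x. e \<le> dist p x})" by (rule e(2))
    show "uncountable (S \<inter> cball p (e/2))" using p(2)[of "e/2"] e(1) by simp
    show "S \<inter> {x. e \<le> dist p x} \<inter> (S \<inter> cball p (e/2)) = {}" using e(1) by auto
  qed
qed

text \<open>Iterates the splitting. The newest bit stands at the head of the list, so the ancestors
  of a node are obtained by \<open>drop\<close>.\<close>

lemma cantor_tree:
  assumes "compact (UNIV :: 'a::metric_space set)" "uncountable (UNIV :: 'a set)"
  shows "\<exists>node :: bool list \<Rightarrow> 'a set. (\<forall>l. compact (node l) \<and> node l \<noteq> {}) \<and>
    (\<forall>b l. node (b # l) \<subseteq> node l) \<and>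
    (\<forall>l l'. length l = length l' \<longrightarrow> l \<noteq> l' \<longrightarrow> node l \<inter> node l' = {})"
proof -
  define good where "good S \<longleftrightarrow> compact S \<and> uncountable S" for S :: "'a set"
  have "\<forall>S. \<exists>A B. good S \<longrightarrow> A \<subseteq> S \<and> B \<subseteq> S \<and> good A \<and> good B \<and> A \<inter> B = {}"
    using uncountable_split unfolding good_def by metis
  then obtain L R where LR: "\<And>S. good S \<Longrightarrow> L S \<subseteq> S \<and> R S \<subseteq> S \<and> good (L S) \<and> good (R S) \<and> L S \<inter> R S = {}"
    by metis
  define node where "node l = foldr (\<lambda>b S. if b then L S else R S) l UNIV" for l
  have node_Cons: "node (b # l) = (if b then L (node l) else R (node l))" for b l by (simp add: node_def)
  have good_node: "good (node l)" for l
  proof (induction l)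
    case Nil then show ?case using assms by (simp add: node_def good_def)
  next
    case (Cons b l) then show ?case using LR by (simp add: node_Cons)
  qed
  have sub: "node (b # l) \<subseteq> node l" for b l using LR[OF good_node] by (simp add: node_Cons)
  have "node l \<inter> node l' = {}" if "length l = length l'" "l \<noteq> l'" for l l'
    using that
  proof (induction l l' rule: list_induct2)
    case (Cons b l b' l')
    show ?case
    proof (cases "l = l'")
      case True
      then have "b \<noteq> b'" using Cons.prems by simp
      then show ?thesis using LR[OF good_node[of l]] True by (cases b; cases b') (auto simp: node_Cons)
    next
      case False
      then show ?thesis using Cons.IH sub[of b l] sub[of b' l'] by blast
    qed
  qed simp
  moreover have "compact (node l) \<and> node l \<noteq> {}" for l
    using good_node[of l] by (auto simp: good_def)
  ultimately show ?thesis using sub by blast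
qed

text \<open>Disjoint compact sets have positive distance, and each level has finitely many pairs of
  nodes.\<close>

lemma tree_separation:
  fixes node :: "bool list \<Rightarrow> 'a::metric_space set"
  assumes cpt: "\<And>l. compact (node l)"
    and disj: "\<And>l l'. length l = length l' \<Longrightarrow> l \<noteq> l' \<Longrightarrow> node l \<inter> node l' = {}"
  shows "\<exists>r. \<forall>k. r k > 0 \<and> (\<forall>l l' x y. length l = k \<longrightarrow> length l' = k \<longrightarrow> l \<noteq> l' \<longrightarrow>
     x \<in> node l \<longrightarrow> y \<in> node l' \<longrightarrow> r k < dist x y)"
proof -
  have "\<exists>r>0. \<forall>l l' x y. length l = k \<longrightarrow> length l' = k \<longrightarrow> l \<noteq> l' \<longrightarrow>
     x \<in> node l \<longrightarrow> y \<in> node l' \<longrightarrow> r < dist x y" for k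
  proof -
    define P where "P = {q :: bool list \<times> bool list. length (fst q) = k \<and> length (snd q) = k \<and> fst q \<noteq> snd q}"
    have "finite ({l :: bool list. length l = k} \<times> {l :: bool list. length l = k})"
      using finite_lists_length_eq[of "UNIV :: bool set" k] by simp
    then have P: "finite P" by (rule finite_subset[rotated]) (auto simp: P_def)
    have "\<exists>d>0. \<forall>x\<in>node (fst q). \<forall>y\<in>node (snd q). d \<le> dist x y" if "q \<in> P" for q
    proof (cases "node (fst q) \<times> node (snd q) = {}")
      case False
      have "continuous_on (node (fst q) \<times> node (snd q)) (\<lambda>v. dist (fst v) (snd v))"
        by (intro continuous_intros)
      then obtain v where v: "v \<in> node (fst q) \<times> node (snd q)"
        "\<And>u. u \<in> node (fst q) \<times> node (snd q) \<Longrightarrow> dist (fst v) (snd v) \<le> dist (fst u) (snd u)"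
        using continuous_attains_inf[OF compact_Times[OF cpt cpt] False] by blast
      have "node (fst q) \<inter> node (snd q) = {}" using that by (intro disj) (auto simp: P_def)
      then have "fst v \<noteq> snd v" using v(1) by (metis disjoint_iff mem_Times_iff)
      then show ?thesis using v(2) by (intro exI[of _ "dist (fst v) (snd v)"]) force
    qed (auto intro: exI[of _ 1])
    then obtain d where d: "\<And>q. q \<in> P \<Longrightarrow> d q > 0"
      "\<And>q x y. q \<in> P \<Longrightarrow> x \<in> node (fst q) \<Longrightarrow> y \<in> node (snd q) \<Longrightarrow> d q \<le> dist x y" by metis
    \<comment> \<open>The inserted 1 covers level 0, which has no pair of distinct nodes; halving
      \<open>m\<close> below makes the separation strict.\<close>
    define m where "m = Min (insert 1 (d ` P))"
    have m0: "m > 0" unfolding m_def using P d(1) by (subst Min_gr_iff) auto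
    have "m / 2 < dist x y" if "length l = k" "length l' = k" "l \<noteq> l'" "x \<in> node l" "y \<in> node l'" for l l' x y
    proof -
      have q: "(l, l') \<in> P" using that by (simp add: P_def)
      have "m \<le> d (l, l')" unfolding m_def using P q by (intro Min_le) auto
      then show ?thesis using d(2)[OF q, of x y] that m0 by simp
    qed
    then show ?thesis using m0 by (intro exI[of _ "m/2"]) auto
  qed
  then show ?thesis by metis
qed

text \<open>For \<open>t\<close> below the target dimension the sum over the scales is a convergent
  geometric series, whatever the distance. The masses at level \<open>k\<close> halve with each step
  and beat the polynomial loss, because the radii \<open>r k\<close> are tuned to the tree.\<close>

lemma energy_family_of_tree:
  fixes p :: "nat \<Rightarrow> nat \<Rightarrow> 'a::metric_space" and node :: "bool list \<Rightarrow> 'a set"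
  assumes t: "t < real CARD('n::finite)"
    and ne: "\<And>l. node l \<noteq> {}" and sub: "\<And>b l. node (b # l) \<subseteq> node l"
    and r: "\<And>k. r k > 0"
    and sep: "\<And>k l l' x y. length l = k \<Longrightarrow> length l' = k \<Longrightarrow> l \<noteq> l' \<Longrightarrow>
     x \<in> node l \<Longrightarrow> y \<in> node l' \<Longrightarrow> r k < dist x y"
    and net: "\<And>k x. \<exists>i<N k. dist x (p k i) \<le> r k / 4"
  shows "\<exists>c>0. \<exists>C. \<forall>J. \<exists>X \<mu>. finite X \<and> (\<forall>x. 0 \<le> \<mu> x) \<and> c \<le> sum \<mu> X \<and>
    (\<forall>g :: 'a \<Rightarrow>\<^sub>C (real^'n). (\<integral>\<^sup>+\<omega>. ennreal (energy t J X \<mu> (rfun r N p \<omega> + g)) \<partial>coeffs_measure) \<le> ennreal C)"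
proof -
  let ?d = "CARD('n)"
  define q where "q = 2 powr (t - real ?d)"
  have q: "0 < q" "q < 1" using t by (auto simp: q_def powr_less_one)
  \<comment> \<open>Points of level \<open>k > 0\<close> share an ancestor at depth
    \<open>k - 1\<close>, of mass twice \<open>(1/2)^k\<close>.\<close>
  define w where "w k = 2 * (1/2::real)^k" for k :: nat
  define S where "S k = 1 / (1 - q)" for k :: nat
  define M where "M k = 12 ^ ?d * (1 / (1 - q)) * 2 * (real (Suc k) ^ (2 * ?d) * (1/2) ^ k)" for k
  have M_sum: "summable M" unfolding M_def by (intro summable_mult summable_poly_geometric) auto
  have M0: "M k \<ge> 0" for k using q by (simp add: M_def)
  have term_eq: "(12 / amp k) ^ ?d * S k * w k = M k" for k
    unfolding S_def w_def inverse_amp_power M_def by (simp only: mult_ac)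
  define pt where "pt l = (SOME x. x \<in> node l)" for l
  have pt: "pt l \<in> node l" for l unfolding pt_def using ne[of l] some_in_eq by metis
  have sub_drop: "node l \<subseteq> node (drop j l)" for j l
  proof (induction j arbitrary: l)
    case (Suc j)
    show ?case
    proof (cases l)
      case (Cons b l')
      then show ?thesis using Suc.IH[of l'] sub[of b l'] by simp
    qed simp
  qed simp
  have "\<exists>X \<mu>. finite X \<and> (\<forall>x. 0 \<le> \<mu> x) \<and> 1 \<le> sum \<mu> X \<and>
    (\<forall>g :: 'a \<Rightarrow>\<^sub>C (real^'n). (\<integral>\<^sup>+\<omega>. ennreal (energy t J X \<mu> (rfun r N p \<omega> + g)) \<partial>coeffs_measure) \<le> ennreal (suminf M + 1))" for J
  proof -
    define T where "T = (\<Sum>j\<le>J. 2 powr (t * real j))"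
    have T0: "T \<ge> 0" unfolding T_def by (intro sum_nonneg) simp
    obtain n where n: "(1/2::real) ^ n < 1 / (T + 1)"
      using real_arch_pow_inv[of "1 / (T + 1)" "1/2"] T0 by auto
    have wn: "T * w (Suc n) \<le> 1"
    proof -
      have "(1/2::real) ^ n * (T + 1) < 1" using n T0 by (simp add: field_simps)
      moreover have "T * w (Suc n) \<le> (1/2) ^ n * (T + 1)" by (simp add: w_def algebra_simps)
      ultimately show ?thesis by linarith
    qed
    define Ls where "Ls = {l :: bool list. length l = n}"
    have card_lists: "card {l :: bool list. length l = m} = 2 ^ m"
      and fin_lists: "finite {l :: bool list. length l = m}" for m
      using card_lists_length_eq[of "UNIV :: bool set" m] finite_lists_length_eq[of "UNIV :: bool set" m] by auto
    have inj: "inj_on pt Ls"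
    proof (rule inj_onI, rule ccontr)
      fix l l' assume l: "l \<in> Ls" "l' \<in> Ls" "pt l = pt l'" "l \<noteq> l'"
      then have "r n < dist (pt l) (pt l')" by (intro sep[of l n l'] pt) (auto simp: Ls_def)
      then show False using l(3) r[of n] by simp
    qed
    define X where "X = pt ` Ls"
    define code where "code = the_inv_into Ls pt"
    have code: "code (pt l) = l" if "l \<in> Ls" for l unfolding code_def by (rule the_inv_into_f_f[OF inj that])
    define \<mu> where "\<mu> x = (1/2::real)^n" for x :: 'a
    have X: "finite X" unfolding X_def Ls_def using fin_lists by simp
    have mass_image: "sum \<mu> (pt ` A) = real (card A) * (1/2)^n" if "A \<subseteq> Ls" for A
      using card_image[OF inj_on_subset[OF inj that]] by (simp add: \<mu>_def)
    have mass: "sum \<mu> X = 1"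
      unfolding X_def using mass_image[of Ls] by (simp add: Ls_def card_lists power_one_over)
    \<comment> \<open>\<open>drop (n - k) l\<close> is the ancestor at depth \<open>k\<close>. The
      cap is \<open>Suc n\<close> because distinct lists may first differ at depth \<open>n\<close>;
      only equal lists reach the cap.\<close>
    define lv where "lv l l' = (LEAST k. drop (n - k) l \<noteq> drop (n - k) l' \<or> k = Suc n)" for l l' :: "bool list"
    define lev where "lev x y = lv (code x) (code y)" for x y
    have lev_le: "lev x y \<le> Suc n" for x y unfolding lev_def lv_def by (rule Least_le) simp
    have lev_sep: "r (lev x y) < dist x y" if xy: "x \<in> X" "y \<in> X" and lt: "lev x y < Suc n" for x y
    proof -
      obtain l l' where l: "l \<in> Ls" "x = pt l" "l' \<in> Ls" "y = pt l'" using xy unfolding X_def by auto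
      let ?k = "lev x y"
      have k: "?k = lv l l'" unfolding lev_def using l code by simp
      have "drop (n - ?k) l \<noteq> drop (n - ?k) l' \<or> ?k = Suc n"
        unfolding k lv_def by (rule LeastI[of _ "Suc n"]) simp
      then have "drop (n - ?k) l \<noteq> drop (n - ?k) l'" using lt by simp
      then show ?thesis
        using l lt sub_drop[of l "n - ?k"] sub_drop[of l' "n - ?k"] pt[of l] pt[of l']
        by (intro sep[of "drop (n - ?k) l" ?k "drop (n - ?k) l'"]) (auto simp: Ls_def)
    qed
    have w_bd: "sum \<mu> {y\<in>X. lev x y = k} \<le> w k" if x: "x \<in> X" and k: "k \<le> Suc n" for x k
    proof (cases k)
      case 0
      have "sum \<mu> {y\<in>X. lev x y = k} \<le> sum \<mu> X" using X by (intro sum_mono2) (auto simp: \<mu>_def)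
      also have "\<dots> \<le> w k" using mass 0 by (simp add: w_def)
      finally show ?thesis .
    next
      case (Suc k')
      then have k': "k' \<le> n" using k by simp
      obtain l where l: "l \<in> Ls" "x = pt l" using x unfolding X_def by auto
      \<comment> \<open>The lists of length \<open>n\<close> below the common ancestor at depth
        \<open>k'\<close>.\<close>
      define A where "A = (\<lambda>m. m @ drop (n - k') l) ` {m :: bool list. length m = n - k'}"
      have "A \<subseteq> Ls" using l k' by (auto simp: A_def Ls_def)
      have cardA: "real (card A) \<le> 2 ^ (n - k')"
        unfolding A_def using card_image_le[OF fin_lists[of "n - k'"], of "\<lambda>m. m @ drop (n - k') l"] card_lists[of "n - k'"]
        by (metis of_nat_le_iff of_nat_numeral of_nat_power)
      have "{y\<in>X. lev x y = k} \<subseteq> pt ` A"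
      proof
        fix y assume y: "y \<in> {y\<in>X. lev x y = k}"
        then obtain l' where l': "l' \<in> Ls" "y = pt l'" unfolding X_def by auto
        have "lv l l' = k" using y l l' code by (simp add: lev_def)
        then have "drop (n - k') l = drop (n - k') l'"
          using not_less_Least[of k' "\<lambda>k. drop (n - k) l \<noteq> drop (n - k) l' \<or> k = Suc n"] Suc
          unfolding lv_def by simp
        then have "l' = take (n - k') l' @ drop (n - k') l" by simp
        moreover have "length (take (n - k') l') = n - k'" using l' by (simp add: Ls_def)
        ultimately have "l' \<in> A" unfolding A_def by blast
        then show "y \<in> pt ` A" using l' by blast
      qed
      then have "sum \<mu> {y\<in>X. lev x y = k} \<le> sum \<mu> (pt ` A)"
        using fin_lists by (intro sum_mono2) (auto simp: \<mu>_def A_def)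
      also have "\<dots> = real (card A) * (1/2)^n" by (rule mass_image[OF \<open>A \<subseteq> Ls\<close>])
      also have "\<dots> \<le> 2 ^ (n - k') * (1/2)^n" by (rule mult_right_mono[OF cardA]) simp
      also have "\<dots> = w k" using k' Suc by (simp add: w_def power_diff power_one_over)
      finally show ?thesis .
    qed
    have S_bd: "(\<Sum>j | j \<le> J \<and> dist x y \<le> (1/2)^j. 2 powr ((t - real ?d) * real j)) \<le> S (lev x y)" for x y :: 'a
    proof -
      have "2 powr ((t - real ?d) * real j) = q ^ j" for j
        by (simp add: q_def powr_powr[symmetric] powr_realpow)
      then have "(\<Sum>j | j \<le> J \<and> dist x y \<le> (1/2)^j. 2 powr ((t - real ?d) * real j)) =
         (\<Sum>j | j \<le> J \<and> dist x y \<le> (1/2)^j. q ^ j)" by simp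
      also have "\<dots> \<le> (\<Sum>j. q ^ j)"
        using q by (intro sum_le_suminf) (auto simp: summable_geometric)
      also have "\<dots> = S (lev x y)" using q by (simp add: S_def suminf_geometric)
      finally show ?thesis .
    qed
    have total: "(\<Sum>k<Suc n. (12 / amp k) ^ ?d * S k * w k) \<le> suminf M"
      unfolding term_eq by (rule sum_le_suminf[OF M_sum]) (auto simp: M0)
    have "(\<integral>\<^sup>+\<omega>. ennreal (energy t J X \<mu> (rfun r N p \<omega> + g)) \<partial>coeffs_measure) \<le> ennreal (suminf M + 1)"
      for g :: "'a \<Rightarrow>\<^sub>C (real^'n)"
    proof (rule expected_energy_le[where lev=lev and n="Suc n" and w=w and S=S, OF r net X])
      show "0 \<le> suminf M" by (rule suminf_nonneg[OF M_sum M0])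
      show "(\<Sum>j\<le>J. 2 powr (t * real j)) * w (Suc n) \<le> 1" using wn unfolding T_def .
      show "0 \<le> S k" for k using q by (simp add: S_def)
      show "0 \<le> \<mu> x" for x by (simp add: \<mu>_def)
      show "sum \<mu> X \<le> 1" using mass by simp
      show "(\<Sum>k<Suc n. (12 / amp k) ^ ?d * S k * w k) \<le> suminf M" by (rule total)
    qed (blast intro: lev_le lev_sep w_bd S_bd)+
    then show ?thesis using X mass by (intro exI[of _ X] exI[of _ \<mu>]) (auto simp: \<mu>_def)
  qed
  then show ?thesis by (intro exI[of _ 1]) auto
qed

section \<open>Combination of the two cases and the dimension formula\<close>

lemma liminf_finite_imp_frequently_le:
  assumes "liminf (\<lambda>J. ennreal (u J)) < \<infinity>"
  obtains C where "\<exists>\<^sub>F J in sequentially. u J \<le> C"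
proof -
  obtain K where K: "liminf (\<lambda>J. ennreal (u J)) = ennreal K" "0 \<le> K"
    using assms by (cases "liminf (\<lambda>J. ennreal (u J))") auto
  have "\<exists>\<^sub>F J in sequentially. u J \<le> K + 1"
  proof (rule ccontr)
    assume "\<not> ?thesis"
    then have "\<forall>\<^sub>F J in sequentially. K + 1 < u J" unfolding not_frequently by (simp add: not_le)
    then have "\<forall>\<^sub>F J in sequentially. ennreal (K + 1) \<le> ennreal (u J)"
      by eventually_elim (simp add: ennreal_leI)
    then have "ennreal (K + 1) \<le> liminf (\<lambda>J. ennreal (u J))" by (rule Liminf_bounded)
    then show False using K by (simp add: ennreal_le_iff)
  qed
  then show ?thesis using that by blast
qed

theorem theorem1p17:
  assumes "compact (UNIV :: 'a::metric_space set)"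
    and "uncountable (UNIV :: 'a set)"
  shows "\<exists>P :: ('a \<Rightarrow>\<^sub>C (real ^ 'n::finite)) set. prevalent P \<and>
           P \<subseteq> {f. hausdorff_dim (graph f) = hausdorff_dim (UNIV :: 'a set) + ereal (real CARD('n))}"
proof -
  let ?D = "hausdorff_dim (UNIV :: 'a set)"
  let ?d = "real CARD('n)"
  \<comment> \<open>Rational exponents keep the family countable and still approach the
    dimension.\<close>
  define T where "T = {t. t \<in> \<rat> \<and> 0 < t \<and> ereal t < ?D + ereal ?d}"
  have T: "countable T" by (rule countable_subset[OF _ countable_rat]) (auto simp: T_def)
  obtain r :: "nat \<Rightarrow> real" and N and p :: "nat \<Rightarrow> nat \<Rightarrow> 'a" where r: "\<And>k. r k > 0" and
    fam: "\<And>t. t \<in> T \<Longrightarrow> \<exists>c>0. \<exists>C. \<forall>J. \<exists>X \<mu>. finite X \<and> (\<forall>x. 0 \<le> \<mu> x) \<and> c \<le> sum \<mu> X \<and>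
      (\<forall>g :: 'a \<Rightarrow>\<^sub>C (real^'n). (\<integral>\<^sup>+\<omega>. ennreal (energy t J X \<mu> (rfun r N p \<omega> + g)) \<partial>coeffs_measure) \<le> ennreal C)"
  \<comment> \<open>One random function has to serve all \<open>t\<close> in \<open>T\<close>, so
    the radii and nets are fixed first; the distinction depends on the space alone.\<close>
  proof (cases "?D = 0")
    case False
    then have D: "0 < ?D" using hausdorff_dim_nonneg[of "UNIV :: 'a set"] by simp
    obtain N and p :: "nat \<Rightarrow> nat \<Rightarrow> 'a" where net: "\<And>k x. \<exists>i<N k. dist x (p k i) \<le> (1/2)^k / 4"
      using compact_nets[OF assms(1), of "\<lambda>k. (1/2)^k / 4"] 
      by (metis divide_pos_pos half_gt_zero_iff zero_less_numeral zero_less_one zero_less_power)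
    show ?thesis
    proof (rule that[of "\<lambda>k. (1/2)^k"])
      fix t assume t: "t \<in> T"
      have "ereal (t - ?d) < ?D" using t by (cases ?D) (auto simp: T_def)
      then have "max (ereal (t - ?d)) 0 < ?D" using D by simp
      then obtain s' where "max (ereal (t - ?d)) 0 < s'" "s' < ?D" using dense by blast
      then obtain s where s: "t - ?d < s" "0 < s" "ereal s < ?D" by (cases s') auto
      show "\<exists>c>0. \<exists>C. \<forall>J. \<exists>X \<mu>. finite X \<and> (\<forall>x. 0 \<le> \<mu> x) \<and> c \<le> sum \<mu> X \<and>
        (\<forall>g :: 'a \<Rightarrow>\<^sub>C (real^'n). (\<integral>\<^sup>+\<omega>. ennreal (energy t J X \<mu> (rfun (\<lambda>k. (1/2)^k) N p \<omega> + g)) \<partial>coeffs_measure) \<le> ennreal C)"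
        by (rule energy_family_of_positive_measure[OF assms(1) s(2,1) _ net])
           (rule hausdorff_measure_nonzero_below_dim, use s in auto)
    qed simp
  next
    case True
    obtain node :: "bool list \<Rightarrow> 'a set" where node: "\<And>l. compact (node l)" "\<And>l. node l \<noteq> {}"
      "\<And>b l. node (b # l) \<subseteq> node l" "\<And>l l'. length l = length l' \<Longrightarrow> l \<noteq> l' \<Longrightarrow> node l \<inter> node l' = {}"
      using cantor_tree[OF assms] by metis
    have "\<exists>r. \<forall>k. r k > 0 \<and> (\<forall>l l' x y. length l = k \<longrightarrow> length l' = k \<longrightarrow> l \<noteq> l' \<longrightarrow>
        x \<in> node l \<longrightarrow> y \<in> node l' \<longrightarrow> r k < dist x y)"
      by (rule tree_separation) (simp_all add: node(1,4))
    then obtain r where "\<forall>k. r k > 0 \<and> (\<forall>l l' x y. length l = k \<longrightarrow> length l' = k \<longrightarrow> l \<noteq> l' \<longrightarrow>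
        x \<in> node l \<longrightarrow> y \<in> node l' \<longrightarrow> r k < dist x y)"
      by (elim exE)
    then have r: "\<And>k. r k > 0" and sep: "\<And>k l l' x y. length l = k \<Longrightarrow> length l' = k \<Longrightarrow> l \<noteq> l' \<Longrightarrow>
        x \<in> node l \<Longrightarrow> y \<in> node l' \<Longrightarrow> r k < dist x y"
      by simp_all
    have "\<exists>(N :: nat \<Rightarrow> nat) p. \<forall>k. \<forall>x::'a. \<exists>i<N k. dist x (p k i) \<le> r k / 4"
      by (rule compact_nets[OF assms(1)]) (simp add: r)
    then obtain N and p :: "nat \<Rightarrow> nat \<Rightarrow> 'a" where net: "\<And>k x. \<exists>i<N k. dist x (p k i) \<le> r k / 4"
      by blast
    show ?thesis
    proof (rule that[of r, OF r])
      fix t assume "t \<in> T"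
      then have "t < ?d" using True by (simp add: T_def)
      then show "\<exists>c>0. \<exists>C. \<forall>J. \<exists>X \<mu>. finite X \<and> (\<forall>x. 0 \<le> \<mu> x) \<and> c \<le> sum \<mu> X \<and>
        (\<forall>g :: 'a \<Rightarrow>\<^sub>C (real^'n). (\<integral>\<^sup>+\<omega>. ennreal (energy t J X \<mu> (rfun r N p \<omega> + g)) \<partial>coeffs_measure) \<le> ennreal C)"
        by (rule energy_family_of_tree[where node=node and r=r]) (use node(2,3) r sep net in blast)+
    qed
  qed
  obtain c C X \<mu> where X: "\<And>t. t \<in> T \<Longrightarrow> c t > 0"
    "\<And>t J. t \<in> T \<Longrightarrow> finite (X t J)" "\<And>t J x. t \<in> T \<Longrightarrow> 0 \<le> \<mu> t J x" "\<And>t J. t \<in> T \<Longrightarrow> c t \<le> sum (\<mu> t J) (X t J)"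
    "\<And>t J (g :: 'a \<Rightarrow>\<^sub>C (real^'n)). t \<in> T \<Longrightarrow>
      (\<integral>\<^sup>+\<omega>. ennreal (energy t J (X t J) (\<mu> t J) (rfun r N p \<omega> + g)) \<partial>coeffs_measure) \<le> ennreal (C t)"
    using fam by metis
  define P where "P = {f :: 'a \<Rightarrow>\<^sub>C (real^'n). \<forall>t\<in>T. liminf (\<lambda>J. ennreal (energy t J (X t J) (\<mu> t J) f)) < \<infinity>}"
  have "prevalent P" unfolding P_def by (rule prevalent_finite_energy[OF r T X(5)])
  moreover have "hausdorff_dim (graph f) = ?D + ereal ?d" if f: "f \<in> P" for f
  proof (rule antisym)
    show "hausdorff_dim (graph f) \<le> ?D + ereal ?d" by (rule hausdorff_dim_graph_le)
    show "?D + ereal ?d \<le> hausdorff_dim (graph f)"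
    proof (rule hausdorff_dim_lower)
      show "graph f \<noteq> {}" by (simp add: graph_def)
      fix s :: real assume s: "0 < s" "ereal s < ?D + ereal ?d"
      obtain t' where t': "ereal s < t'" "t' < ?D + ereal ?d" using dense[OF s(2)] by blast
      then obtain u where u: "s < u" "ereal u < ?D + ereal ?d" by (cases t') auto
      \<comment> \<open>The energy exponent may exceed \<open>s\<close>, so a rational one between
        \<open>s\<close> and the target is enough.\<close>
      obtain q where q: "q \<in> \<rat>" "s < q" "q < u" using Rats_dense_in_real[OF u(1)] by auto
      have qT: "q \<in> T" using q s u by (auto simp: T_def intro: less_trans[of "ereal q" "ereal u"])
      then have "liminf (\<lambda>J. ennreal (energy q J (X q J) (\<mu> q J) f)) < \<infinity>" using f by (simp add: P_def)
      then obtain K where "\<exists>\<^sub>F J in sequentially. energy q J (X q J) (\<mu> q J) f \<le> K"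
        by (rule liminf_finite_imp_frequently_le)
      then show "hausdorff_measure s (graph f) \<noteq> 0"
        using s(1) q(2) X[OF qT]
        by (intro energy_bound_imp_hausdorff_measure_nonzero[OF assms(1), of s q "c q" "X q" "\<mu> q"]) auto
    qed
  qed
  ultimately show ?thesis by blast
qed

end
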